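(* Let $X_d\ge1$ be integers with $X_d\to\infty$ as $d\to\infty$, let $\Omega_d=[1,X_d]\cap\mathbb{Z}$ with the uniform probability measure, and let $$\mathcal{M}_d=\{f:\Omega_d\to\{-1,1\}: f(mn)=f(m)f(n)\text{ for all }m,n\text{ with }mn\le X_d\},$$ equipped with the uniform probability measure. Fix $C>0$ and $0<\delta<1/4$, and suppose that $f(\cdot;\theta_{T_d})$ is a parametric model on $\Omega_d$ trained by noisy gradient descent with target $h$, with hyperparameters satisfying $$T_d\left(\frac{R_d}{\tau_d}\right)^2\ll X_d^{1/2-2\delta}.$$ Then for $d\gg1$, $$\mathbb{P}_{h\sim\mathcal{M}_d,\theta_{T_d}}\left[\|f(\cdot;\theta_{T_d})-h\|_2^2\le\|h-\mathbbm{1}_\square\|_2^2-(\log X_d)^{-C}\right]\ll X_d^{-\delta}.$$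
   Context: $\mathbbm{1}_\square$ is the indicator function of perfect squares, and $\|\cdot\|_2$ is the $L^2$ norm for the uniform probability measure on $\Omega_d$. Inputs $n\in\Omega_d$ may be encoded as points of a Euclidean space in any fixed way (e.g. via digits as roots of unity). Noisy gradient descent: a parametric model $f(\cdot;\theta)$, $\theta\in\mathbb{R}^\eta$, with $\nabla_\theta f$ existing a.e.; random initialization $\theta_0\sim\mu_0$; updates $\theta_{k+1}=\theta_k-\eta_k(G_h(\theta_k)+\xi_k)$ with step sizes $\eta_k>0$, i.i.d. $\xi_k\sim N(0,\tau_d^2I)$, and $G_h(\theta)=-\mathbb{E}_{x\sim\mathrm{unif}(\Omega_d)}[(h(x)-f(x;\theta))\Pi_{R_d}\nabla_\theta f(x;\theta)]$, $\Pi_R$ being projection onto the ball of radius $R$; run for $T_d$ steps. The probability is over $h$ uniform in $\mathcal{M}_d$ and the randomness of initialization and noise. *)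

theory Defs
  imports
    "HOL-Probability.Probability"
    "HOL-Library.Landau_Symbols"
    "HOL-Computational_Algebra.Nth_Powers"
begin

definition mult_sign_funs :: "nat \<Rightarrow> (nat \<Rightarrow> real) set" where
  "mult_sign_funs X =
     {h \<in> {1..X} \<rightarrow>\<^sub>E {-1, 1}.
        \<forall>m\<in>{1..X}. \<forall>n\<in>{1..X}. m * n \<le> X \<longrightarrow> h (m * n) = h m * h n}"

definition avg :: "nat \<Rightarrow> (nat \<Rightarrow> real) \<Rightarrow> real" where
  "avg X u = (\<integral>n. u n \<partial>uniform_count_measure {1..X})"

definition l2norm :: "nat \<Rightarrow> (nat \<Rightarrow> real) \<Rightarrow> real" where
  "l2norm X u = sqrt (avg X (\<lambda>n. (u n)\<^sup>2))"

text \<open>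
  The number \<open>p\<close> of parameters varies with \<open>d\<close>, so a parameter vector is an
  extensional function on the index set \<open>{..<p}\<close> rather than an element of a Euclidean
  space type. The measure is Lebesgue measure on the Borel sets.
\<close>

definition param_space :: "nat \<Rightarrow> (nat \<Rightarrow> real) measure" where
  "param_space p = (\<Pi>\<^sub>M i\<in>{..<p}. lborel)"

text \<open>The gradient is the vector of partial derivatives, and exists where all of them do.\<close>

definition has_gradient ::
    "nat \<Rightarrow> ((nat \<Rightarrow> real) \<Rightarrow> real) \<Rightarrow> (nat \<Rightarrow> real) \<Rightarrow> (nat \<Rightarrow> real) \<Rightarrow> bool" where
  "has_gradient p F v \<theta> \<longleftrightarrow>
     v \<in> extensional {..<p} \<and>
     (\<forall>i<p. ((\<lambda>t. F (\<theta>(i := t))) has_real_derivative v i) (at (\<theta> i)))"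

text \<open>
  A model is a function \<open>f n \<theta>\<close> of the input \<open>n\<close> itself: composing with a fixed encoding
  of the inputs gives another such function. The map \<open>g\<close> is the gradient of \<open>f\<close> in the
  parameters. On the null set where the gradient does not exist, its values, which the
  training may use (the initial parameters can lie there), are unrestricted up to
  measurability.
\<close>

definition param_model ::
    "nat \<Rightarrow> nat \<Rightarrow> (nat \<Rightarrow> (nat \<Rightarrow> real) \<Rightarrow> real) \<Rightarrow>
     (nat \<Rightarrow> (nat \<Rightarrow> real) \<Rightarrow> nat \<Rightarrow> real) \<Rightarrow> bool" where
  "param_model X p f g \<longleftrightarrow>
     (\<forall>n\<in>{1..X}.
        f n \<in> borel_measurable (param_space p) \<and>
        g n \<in> param_space p \<rightarrow>\<^sub>M param_space p \<and>
        (AE \<theta> in param_space p. \<exists>v. has_gradient p (f n) v \<theta>) \<and>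
        (\<forall>\<theta>\<in>space (param_space p). \<forall>v. has_gradient p (f n) v \<theta> \<longrightarrow> g n \<theta> = v))"

definition proj_ball :: "nat \<Rightarrow> real \<Rightarrow> (nat \<Rightarrow> real) \<Rightarrow> nat \<Rightarrow> real" where
  "proj_ball p R v =
     (if L2_set v {..<p} \<le> R then v else (\<lambda>i\<in>{..<p}. R / L2_set v {..<p} * v i))"

definition pop_gradient ::
    "nat \<Rightarrow> nat \<Rightarrow> real \<Rightarrow> (nat \<Rightarrow> (nat \<Rightarrow> real) \<Rightarrow> real) \<Rightarrow>
     (nat \<Rightarrow> (nat \<Rightarrow> real) \<Rightarrow> nat \<Rightarrow> real) \<Rightarrow>
     (nat \<Rightarrow> real) \<Rightarrow> (nat \<Rightarrow> real) \<Rightarrow> nat \<Rightarrow> real" where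
  "pop_gradient X p R f g h \<theta> =
     (\<lambda>i\<in>{..<p}. - avg X (\<lambda>n. (h n - f n \<theta>) * proj_ball p R (g n \<theta>) i))"

primrec noisy_gd ::
    "nat \<Rightarrow> nat \<Rightarrow> real \<Rightarrow> (nat \<Rightarrow> (nat \<Rightarrow> real) \<Rightarrow> real) \<Rightarrow>
     (nat \<Rightarrow> (nat \<Rightarrow> real) \<Rightarrow> nat \<Rightarrow> real) \<Rightarrow> (nat \<Rightarrow> real) \<Rightarrow>
     (nat \<Rightarrow> real) \<Rightarrow> (nat \<Rightarrow> real) \<Rightarrow> (nat \<Rightarrow> nat \<Rightarrow> real) \<Rightarrow> nat \<Rightarrow> nat \<Rightarrow> real" where
  "noisy_gd X p R f g \<eta> h \<theta>0 \<xi> 0 = \<theta>0"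
| "noisy_gd X p R f g \<eta> h \<theta>0 \<xi> (Suc k) =
     (let \<theta> = noisy_gd X p R f g \<eta> h \<theta>0 \<xi> k
      in (\<lambda>i\<in>{..<p}. \<theta> i - \<eta> k * (pop_gradient X p R f g h \<theta> i + \<xi> k i)))"

text \<open>The centred Gaussian measure with covariance matrix \<open>\<tau>\<^sup>2 I\<close>.\<close>

definition gaussian_noise :: "nat \<Rightarrow> real \<Rightarrow> (nat \<Rightarrow> real) measure" where
  "gaussian_noise p \<tau> = (\<Pi>\<^sub>M i\<in>{..<p}. density lborel (normal_density 0 \<tau>))"

text \<open>Outcomes are triples of a target, initial parameters and the noise of the steps \<open>k < T\<close>.\<close>

definition training_space ::
    "nat \<Rightarrow> nat \<Rightarrow> real \<Rightarrow> nat \<Rightarrow> (nat \<Rightarrow> real) measure \<Rightarrow>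
     ((nat \<Rightarrow> real) \<times> (nat \<Rightarrow> real) \<times> (nat \<Rightarrow> nat \<Rightarrow> real)) measure" where
  "training_space X p \<tau> T \<mu>0 =
     uniform_count_measure (mult_sign_funs X) \<Otimes>\<^sub>M
       (\<mu>0 \<Otimes>\<^sub>M (\<Pi>\<^sub>M k\<in>{..<T}. gaussian_noise p \<tau>))"

end

theory Submission
  imports Defs "HOL-Computational_Algebra.Squarefree" "HOL-Real_Asymp.Real_Asymp"
begin

text \<open>
  Compare training on \<open>h\<close> with training on the indicator of the squares, which does not depend on
  \<open>h\<close>. The covariance of \<open>h m\<close> and \<open>h n\<close> vanishes unless \<open>m * n\<close> is a square, so for every
  function \<open>u\<close> the mean over \<open>h\<close> of the squared correlation of \<open>u\<close> with \<open>h\<close> minus the indicator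
  is at most \<open>avg X (\<lambda>n. (u n)\<^sup>2) / sqrt X\<close>.
  Applied to the coordinates of the clipped gradients, this bounds the mean relative entropy of the two
  runs by \<open>T * R\<^sup>2 / (2 * \<tau>\<^sup>2 * sqrt X)\<close>; applied to the output of the reference run, Chebyshev's
  inequality bounds its probability of beating the indicator by a margin \<open>L\<close> by \<open>1 / (L * sqrt X)\<close>.
  As the latter probability is already small, a linearised Donsker--Varadhan inequality transfers it
  to the run on \<open>h\<close> without the square root that Pinsker's inequality would cost.
\<close>

section \<open>Correlations of random multiplicative functions\<close>

lemma odd_multiplicity_of_not_square:
  assumes "\<not> is_square (m::nat)"
  obtains q where "prime q" "odd (multiplicity q m)"
proof -
  have "m \<noteq> 0"
    using assms by (intro notI) simp
  with assms show thesis
    using is_nth_power_conv_multiplicity_nat[of 2 m] that by auto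
qed

lemma square_mult_even_multiplicity:
  assumes "is_square (m * n)" "m > 0" "n > (0::nat)" "prime q"
  shows "even (multiplicity q m) \<longleftrightarrow> even (multiplicity q n)"
proof -
  have "even (multiplicity q (m * n))"
    using assms is_nth_power_conv_multiplicity_nat[of 2 "m * n"] by auto
  thus ?thesis
    using assms by (simp add: prime_elem_multiplicity_mult_distrib)
qed

text \<open>A square product forces equal parities of the exponents of every prime in
  \<open>m\<close> and \<open>n\<close>, and these parities are all that the squarefree part
  records.\<close>

lemma squarefree_part_eq_of_square_mult:
  assumes "is_square (m * n)" "m > 0" "n > (0::nat)"
  shows "squarefree_part m = squarefree_part n"
proof (rule multiplicity_eq_nat)
  fix q :: nat assume "prime q"
  thus "multiplicity q (squarefree_part m) = multiplicity q (squarefree_part n)"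
    using square_mult_even_multiplicity[OF assms] assms
    by (simp add: prime_multiplicity_squarefree_part mod2_eq_if)
qed (simp_all add: zero_less_iff_neq_zero)

text \<open>All such \<open>n\<close> have the squarefree part of \<open>m\<close>, so each is
  determined by its square part \<open>a\<close>, and \<open>a ^ 2 \<le> n \<le> X\<close> leaves at
  most \<open>sqrt X\<close> choices of \<open>a\<close>. This is the source of every
  \<open>sqrt X\<close> in the final bound.\<close>

lemma card_square_mult_le:
  assumes "m > (0::nat)"
  shows "real (card {n\<in>{1..X}. is_square (m * n)}) \<le> sqrt (real X)"
proof -
  let ?S = "{n\<in>{1..X}. is_square (m * n)}"
  have "inj_on square_part ?S"
  proof (rule inj_onI)
    fix a b assume "a \<in> ?S" "b \<in> ?S" and eq: "square_part a = square_part b"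
    hence "squarefree_part a = squarefree_part b"
      using squarefree_part_eq_of_square_mult[of m a] squarefree_part_eq_of_square_mult[of m b] assms
      by simp
    with eq show "a = b"
      using squarefree_decompose[of a] squarefree_decompose[of b] by metis
  qed
  moreover have "square_part ` ?S \<subseteq> {1..nat \<lfloor>sqrt (real X)\<rfloor>}"
  proof safe
    fix a assume a: "a \<in> {1..X}"
    have "square_part a ^ 2 \<le> a"
      using a by (intro dvd_imp_le) auto
    hence "real (square_part a) ^ 2 \<le> real X"
      using a by (metis atLeastAtMost_iff le_trans of_nat_le_iff of_nat_power)
    hence "real (square_part a) \<le> sqrt (real X)"
      by (simp add: real_le_rsqrt)
    moreover have "1 \<le> square_part a"
      using a by (metis square_part_0_iff atLeastAtMost_iff less_one linorder_not_le not_one_le_zero)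
    ultimately show "square_part a \<in> {1..nat \<lfloor>sqrt (real X)\<rfloor>}"
      by (simp add: le_nat_floor)
  qed
  ultimately have "card ?S \<le> nat \<lfloor>sqrt (real X)\<rfloor>"
    using card_inj_on_le[of square_part ?S "{1..nat \<lfloor>sqrt (real X)\<rfloor>}"] by simp
  moreover have "real (nat \<lfloor>sqrt (real X)\<rfloor>) \<le> sqrt (real X)"
    by simp
  ultimately show ?thesis
    by linarith
qed

section \<open>The finite set of targets and its sign symmetries\<close>

lemma mult_sign_funs_values:
  "h \<in> mult_sign_funs X \<Longrightarrow> n \<in> {1..X} \<Longrightarrow> h n = 1 \<or> h n = -1"
  unfolding mult_sign_funs_def by (auto dest: PiE_mem)

lemma finite_mult_sign_funs: "finite (mult_sign_funs X)"
  by (rule finite_subset[of _ "{1..X} \<rightarrow>\<^sub>E {-1, 1}"]) (auto simp: mult_sign_funs_def intro: finite_PiE)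

lemma mult_sign_funs_nonempty: "mult_sign_funs X \<noteq> {}"
proof -
  have "restrict (\<lambda>_. 1) {1..X} \<in> mult_sign_funs X"
    unfolding mult_sign_funs_def by auto
  thus ?thesis by blast
qed

lemma mult_sign_funs_square:
  assumes "h \<in> mult_sign_funs X" "n \<in> {1..X}" "is_square n"
  shows "h n = 1"
proof -
  obtain a where a: "n = a ^ 2"
    using assms(3) by (elim is_nth_powerE)
  hence "a \<in> {1..X}"
    using assms(2) by (auto simp: power2_eq_square dest: order_trans[OF le_square] intro: Suc_leI)
  moreover have "h (a * a) = h a * h a"
    using assms(1,2) a \<open>a \<in> {1..X}\<close> unfolding mult_sign_funs_def by (auto simp: power2_eq_square)
  ultimately show ?thesis
    using mult_sign_funs_values[OF assms(1), of a] a by (auto simp: power2_eq_square)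
qed

text \<open>
  Multiplying by the completely multiplicative function \<open>n \<mapsto> (-1)^v\<^sub>q(n)\<close> is an involution of the
  targets, which changes the sign of \<open>h m * h n\<close> if \<open>q\<close> has odd multiplicity in \<open>m * n\<close>.
\<close>

lemma sum_mult_sign_funs_eq_0:
  assumes "m \<in> {1..X}" "n \<in> {1..X}" "\<not> is_square (m * n)"
  shows "(\<Sum>h\<in>mult_sign_funs X. h m * h n) = 0"
proof -
  obtain q where q: "prime q" "odd (multiplicity q (m * n))"
    using odd_multiplicity_of_not_square[OF assms(3)] .
  define w where "w = (\<lambda>h::nat\<Rightarrow>real. \<lambda>k\<in>{1..X}. h k * (-1) ^ multiplicity q k)"
  have w_mem: "w h \<in> mult_sign_funs X" if "h \<in> mult_sign_funs X" for h
  proof -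
    have "w h \<in> {1..X} \<rightarrow>\<^sub>E {-1, 1}"
      using mult_sign_funs_values[OF that] by (fastforce simp: w_def minus_one_power_iff)
    moreover have "w h (a * b) = w h a * w h b" if ab: "a \<in> {1..X}" "b \<in> {1..X}" "a * b \<le> X" for a b
    proof -
      have "h (a * b) = h a * h b"
        using \<open>h \<in> mult_sign_funs X\<close> ab by (auto simp: mult_sign_funs_def)
      moreover have "multiplicity q (a * b) = multiplicity q a + multiplicity q b"
        using ab q by (intro prime_elem_multiplicity_mult_distrib) auto
      ultimately show ?thesis
        using ab by (auto simp: w_def power_add Suc_le_eq)
    qed
    ultimately show ?thesis
      by (auto simp: mult_sign_funs_def)
  qed
  have ww: "w (w h) = h" if "h \<in> mult_sign_funs X" for h
  proof
    fix k show "w (w h) k = h k"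
    proof (cases "k \<in> {1..X}")
      case False
      \<comment> \<open>Targets are extensional, so outside \<open>{1..X}\<close> both sides have
        the default value.\<close>
      moreover have "h k = undefined"
        using that False unfolding mult_sign_funs_def by (blast intro: PiE_arb)
      ultimately show ?thesis
        unfolding w_def by simp
    qed (simp add: w_def minus_one_power_iff)
  qed
  have "(\<Sum>h\<in>mult_sign_funs X. h m * h n) = (\<Sum>h\<in>mult_sign_funs X. w h m * w h n)"
    by (rule sum.reindex_bij_witness[of _ w w]) (simp_all add: w_mem ww)
  also have "\<dots> = (\<Sum>h\<in>mult_sign_funs X. - (h m * h n))"
  proof (rule sum.cong)
    fix h
    have "odd (multiplicity q m + multiplicity q n)"
      using q assms by (simp add: prime_elem_multiplicity_mult_distrib)
    thus "w h m * w h n = - (h m * h n)"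
      using assms by (auto simp: w_def minus_one_power_iff)
  qed simp
  finally show ?thesis
    by (simp add: sum_negf)
qed

lemma avg_eq_sum: "avg X u = (\<Sum>n\<in>{1..X}. u n) / X"
  unfolding avg_def by (simp add: integral_uniform_count_measure)

lemma l2norm_sq: "(l2norm X u)\<^sup>2 = avg X (\<lambda>n. (u n)\<^sup>2)"
  unfolding l2norm_def by (simp add: avg_eq_sum sum_nonneg)

text \<open>
  On \<open>{1..X}\<close> the function \<open>h - of_bool \<circ> is_square\<close> is \<open>h\<close> restricted to the non-squares, so its
  covariance matrix vanishes off the pairs with square product, of which every row has at most \<open>sqrt X\<close>.
\<close>

lemma cross_predictability:
  fixes u :: "nat \<Rightarrow> real"
  shows "(\<Sum>h\<in>mult_sign_funs X. (avg X (\<lambda>n. u n * (h n - of_bool (is_square n))))\<^sup>2)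
    \<le> card (mult_sign_funs X) * (avg X (\<lambda>n. (u n)\<^sup>2) / sqrt X)"
\<comment> \<open>Averages over the empty range are divisions by zero, hence 0.\<close>
proof (cases "X = 0")
  case True thus ?thesis by (simp add: avg_eq_sum)
next
  case False
  let ?M = "mult_sign_funs X"
  \<comment> \<open>Up to the factor \<open>card ?M\<close>, \<open>c\<close> is the second moment
    matrix of \<open>h\<close> minus the indicator. It is dominated entrywise by the 0-1 matrix
    \<open>b\<close> of pairs with square product.\<close>
  define c where "c = (\<lambda>m n. \<Sum>h\<in>?M. (h m - of_bool (is_square m)) * (h n - of_bool (is_square n)))"
  define b :: "nat \<Rightarrow> nat \<Rightarrow> real" where "b = (\<lambda>m n. of_bool (is_square (m * n)))"
  have c_le: "\<bar>c m n\<bar> \<le> card ?M * b m n" if mn: "m \<in> {1..X}" "n \<in> {1..X}" for m n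
  proof (cases "is_square m \<or> is_square n")
    case True
    hence "c m n = 0"
      unfolding c_def using mn by (intro sum.neutral) (auto simp: mult_sign_funs_square)
    thus ?thesis by (simp add: b_def)
  next
    case nsq: False
    hence c: "c m n = (\<Sum>h\<in>?M. h m * h n)"
      by (simp add: c_def)
    show ?thesis
    proof (cases "is_square (m * n)")
      case True
      have "\<bar>c m n\<bar> \<le> (\<Sum>h\<in>?M. \<bar>h m * h n\<bar>)"
        unfolding c by (rule sum_abs)
      also have "\<dots> = (\<Sum>h\<in>?M. 1)"
      proof (rule sum.cong)
        fix h assume "h \<in> ?M"
        thus "\<bar>h m * h n\<bar> = 1"
          using mult_sign_funs_values[of h X m] mult_sign_funs_values[of h X n] mn
          by (auto simp: abs_mult)
      qed simp
      finally show ?thesis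
        using True by (simp add: b_def)
    next
      case False
      thus ?thesis
        using sum_mult_sign_funs_eq_0[OF mn False] by (simp add: c b_def)
    qed
  qed
  have b_sum: "(\<Sum>n\<in>{1..X}. b m n) \<le> sqrt X" if "m \<in> {1..X}" for m
  proof -
    have "(\<Sum>n\<in>{1..X}. b m n) = card {n\<in>{1..X}. is_square (m * n)}"
      unfolding b_def by (simp add: sum.If_cases Int_def flip: of_bool_def)
    thus ?thesis
      using card_square_mult_le[of m X] that by simp
  qed
  have b_sym: "b m n = b n m" for m n
    by (simp add: b_def mult.commute)
  have "(\<Sum>h\<in>?M. (\<Sum>n\<in>{1..X}. u n * (h n - of_bool (is_square n)))\<^sup>2)
      = (\<Sum>h\<in>?M. \<Sum>m\<in>{1..X}. \<Sum>n\<in>{1..X}. u m * u n *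
          ((h m - of_bool (is_square m)) * (h n - of_bool (is_square n))))"
    unfolding power2_eq_square sum_product by (simp only: mult_ac)
  also have "\<dots> = (\<Sum>m\<in>{1..X}. \<Sum>h\<in>?M. \<Sum>n\<in>{1..X}. u m * u n *
          ((h m - of_bool (is_square m)) * (h n - of_bool (is_square n))))"
    by (rule sum.swap)
  also have "\<dots> = (\<Sum>m\<in>{1..X}. \<Sum>n\<in>{1..X}. u m * u n * c m n)"
    unfolding c_def sum_distrib_left by (intro sum.cong refl sum.swap)
  \<comment> \<open>Schur's test: after \<open>\<bar>u m * u n\<bar> \<le> ((u m)\<^sup>2 + (u
    n)\<^sup>2) / 2\<close>, the symmetry of \<open>b\<close> bounds the quadratic form by the
    largest row sum times the sum of the squares of \<open>u\<close>.\<close>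
  also have "\<dots> \<le> (\<Sum>m\<in>{1..X}. \<Sum>n\<in>{1..X}. (((u m)\<^sup>2 + (u n)\<^sup>2) / 2) * (card ?M * b m n))"
  proof (intro sum_mono)
    fix m n assume mn: "m \<in> {1..X}" "n \<in> {1..X}"
    have "u m * u n * c m n \<le> \<bar>u m * u n\<bar> * \<bar>c m n\<bar>"
      by (metis abs_ge_self abs_mult)
    also have "\<dots> \<le> (((u m)\<^sup>2 + (u n)\<^sup>2) / 2) * (card ?M * b m n)"
    proof (intro mult_mono c_le mn)
      have "0 \<le> (\<bar>u m\<bar> - \<bar>u n\<bar>)\<^sup>2"
        by simp
      thus "\<bar>u m * u n\<bar> \<le> ((u m)\<^sup>2 + (u n)\<^sup>2) / 2"
        by (simp add: power2_diff abs_mult)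
    qed auto
    finally show "u m * u n * c m n \<le> (((u m)\<^sup>2 + (u n)\<^sup>2) / 2) * (card ?M * b m n)" .
  qed
  also have "\<dots> = card ?M / 2 * ((\<Sum>m\<in>{1..X}. \<Sum>n\<in>{1..X}. (u m)\<^sup>2 * b m n)
      + (\<Sum>m\<in>{1..X}. \<Sum>n\<in>{1..X}. (u n)\<^sup>2 * b m n))"
    by (simp add: sum_distrib_left algebra_simps add_divide_distrib flip: sum.distrib)
  also have "(\<Sum>m\<in>{1..X}. \<Sum>n\<in>{1..X}. (u n)\<^sup>2 * b m n) = (\<Sum>m\<in>{1..X}. \<Sum>n\<in>{1..X}. (u m)\<^sup>2 * b m n)"
    by (subst sum.swap) (simp add: b_sym)
  also have "card ?M / 2 * ((\<Sum>m\<in>{1..X}. \<Sum>n\<in>{1..X}. (u m)\<^sup>2 * b m n) +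
      (\<Sum>m\<in>{1..X}. \<Sum>n\<in>{1..X}. (u m)\<^sup>2 * b m n)) =
      card ?M * (\<Sum>m\<in>{1..X}. (u m)\<^sup>2 * (\<Sum>n\<in>{1..X}. b m n))"
    by (simp add: sum_distrib_left)
  also have "\<dots> \<le> card ?M * (\<Sum>m\<in>{1..X}. (u m)\<^sup>2 * sqrt X)"
    by (intro mult_left_mono sum_mono b_sum) auto
  finally have le: "(\<Sum>h\<in>?M. (\<Sum>n\<in>{1..X}. u n * (h n - of_bool (is_square n)))\<^sup>2)
      \<le> card ?M * ((\<Sum>m\<in>{1..X}. (u m)\<^sup>2) * sqrt X)"
    by (simp add: sum_distrib_right)
  have "(\<Sum>h\<in>?M. (avg X (\<lambda>n. u n * (h n - of_bool (is_square n))))\<^sup>2)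
      = (\<Sum>h\<in>?M. (\<Sum>n\<in>{1..X}. u n * (h n - of_bool (is_square n)))\<^sup>2) / (real X)\<^sup>2"
    by (simp add: avg_eq_sum power_divide flip: sum_divide_distrib)
  also have "\<dots> \<le> card ?M * ((\<Sum>m\<in>{1..X}. (u m)\<^sup>2) * sqrt X) / (real X)\<^sup>2"
    by (rule divide_right_mono[OF le]) simp
  \<comment> \<open>One factor \<open>1 / X\<close> forms the average; the other turns
    \<open>sqrt X\<close> into \<open>1 / sqrt X\<close>.\<close>
  also have "\<dots> = card ?M * (avg X (\<lambda>n. (u n)\<^sup>2) / sqrt X)"
    using False by (simp add: avg_eq_sum power2_eq_square real_div_sqrt field_simps)
  finally show ?thesis .
qed

section \<open>Relative entropy of shifted Gaussian measures\<close>

text \<open>The Donsker--Varadhan inequality for two Gaussians of equal variance whose means differ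
  by \<open>a\<close>; the subtracted term is their relative entropy. An affine substitution moves
  the shift into the exponent, and Jensen's inequality for \<open>exp\<close> does the rest.\<close>

lemma gaussian_shift_inequality:
  fixes \<psi> :: "real \<Rightarrow> real"
  assumes [measurable]: "\<psi> \<in> borel_measurable borel" and bnd: "\<And>x. \<bar>\<psi> x\<bar> \<le> b" and \<tau>: "\<tau> > 0"
  defines "N \<equiv> density lborel (normal_density 0 \<tau>)"
  shows "exp ((\<integral>x. \<psi> x \<partial>N) - a\<^sup>2 / (2 * \<tau>\<^sup>2)) \<le> (\<integral>x. exp (\<psi> (x + a)) \<partial>N)"
proof -
  interpret N: prob_space N
    unfolding N_def by (rule prob_space_normal_density[OF \<tau>])
  have [measurable_cong]: "sets N = sets borel"
    by (simp add: N_def)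
  define c where "c = (\<integral>x. \<psi> x \<partial>N) - a\<^sup>2 / (2 * \<tau>\<^sup>2)"
  \<comment> \<open>\<open>\<psi>\<close> plus the log-ratio of the densities of \<open>N\<close> shifted by \<open>a\<close> and of \<open>N\<close>\<close>
  define \<phi> where "\<phi> = (\<lambda>x. \<psi> x + (2 * x * a - a\<^sup>2) / (2 * \<tau>\<^sup>2))"
  have intN_\<psi>: "integrable N \<psi>"
    by (rule N.integrable_const_bound[of _ b]) (auto simp: bnd)
  have intN_x: "integrable N (\<lambda>x. x)" and mean: "(\<integral>x. x \<partial>N) = 0"
    unfolding N_def using integrable_normal_moment_nz_1[OF \<tau>, of 0] integral_normal_moment_nz_1[OF \<tau>, of 0]
    by (simp_all add: integrable_density integral_density)
  have int_\<phi>: "integrable N \<phi>"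
    unfolding \<phi>_def by (intro Bochner_Integration.integrable_add integrable_divide
        Bochner_Integration.integrable_diff integrable_mult_left integrable_mult_right intN_\<psi> intN_x) simp
  have "(\<integral>x. \<phi> x \<partial>N) = c"
    unfolding \<phi>_def c_def using intN_\<psi> intN_x mean
    by (simp add: diff_divide_distrib integrable_divide N.prob_space)
  \<comment> \<open>The integrand is the tangent line of \<open>exp\<close> at the mean
    \<open>c\<close> of \<open>\<phi>\<close>, evaluated at \<open>\<phi> x\<close>. Its lying below
    \<open>exp (\<phi> x)\<close> is what yields Jensen's inequality.\<close>
  hence "(\<integral>x. exp c * (1 + (\<phi> x - c)) \<partial>N) = exp c"
    using int_\<phi> by (simp add: N.prob_space)
  have shift: "normal_density 0 \<tau> (x - a) = normal_density 0 \<tau> x * exp ((2 * x * a - a\<^sup>2) / (2 * \<tau>\<^sup>2))" for x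
  proof -
    have "- (x - a)\<^sup>2 / (2 * \<tau>\<^sup>2) = - x\<^sup>2 / (2 * \<tau>\<^sup>2) + (2 * x * a - a\<^sup>2) / (2 * \<tau>\<^sup>2)"
      by (simp add: power2_diff add_divide_distrib diff_divide_distrib)
    thus ?thesis
      by (simp add: normal_density_def flip: exp_add)
  qed
  have intl: "integrable lborel (\<lambda>x. normal_density 0 \<tau> x * exp (\<psi> (x + a)))"
    by (rule Bochner_Integration.integrable_bound[where f = "\<lambda>x. normal_density 0 \<tau> x * exp b"])
      (auto simp: abs_mult abs_le_D1[OF bnd] intro!: AE_I2 mult_left_mono \<tau>)
  \<comment> \<open>The shape \<open>-a + 1 * x\<close> matches the affine substitution rule for
    \<open>lborel\<close>.\<close>
  have eq: "(\<lambda>x. normal_density 0 \<tau> (-a + 1 * x) * exp (\<psi> (-a + 1 * x + a)))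
      = (\<lambda>x. normal_density 0 \<tau> x * exp (\<phi> x))"
    using shift by (simp add: \<phi>_def exp_add fun_eq_iff mult.assoc mult.commute)
  have int_e\<phi>: "integrable N (\<lambda>x. exp (\<phi> x))"
    unfolding N_def using lborel_integrable_real_affine[OF intl, of 1 "-a"] unfolding eq
    by (subst integrable_density) (auto simp: \<phi>_def)
  have "(\<integral>x. exp (\<psi> (x + a)) \<partial>N) = (\<integral>x. normal_density 0 \<tau> x * exp (\<psi> (x + a)) \<partial>lborel)"
    unfolding N_def by (subst integral_density) auto
  also have "\<dots> = (\<integral>x. normal_density 0 \<tau> x * exp (\<phi> x) \<partial>lborel)"
    by (subst lborel_integral_real_affine[of 1 _ "-a"]) (simp_all only: eq, auto)
  also have "\<dots> = (\<integral>x. exp (\<phi> x) \<partial>N)"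
    unfolding N_def by (subst integral_density) (auto simp: \<phi>_def)
  also have "\<dots> \<ge> (\<integral>x. exp c * (1 + (\<phi> x - c)) \<partial>N)"
  proof (rule integral_mono)
    show "integrable N (\<lambda>x. exp c * (1 + (\<phi> x - c)))"
      using int_\<phi> by simp
    fix x
    have "exp c * (1 + (\<phi> x - c)) \<le> exp c * exp (\<phi> x - c)"
      by (intro mult_left_mono exp_ge_add_one_self) simp
    thus "exp c * (1 + (\<phi> x - c)) \<le> exp (\<phi> x)"
      by (simp flip: exp_add)
  qed (rule int_e\<phi>)
  finally show ?thesis
    using \<open>(\<integral>x. exp c * (1 + (\<phi> x - c)) \<partial>N) = exp c\<close> by (simp add: c_def)
qed

text \<open>Relative entropy is additive over independent coordinates, so the one-dimensional
  inequality is applied to one coordinate at a time, by induction on the index set.\<close>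

lemma gaussian_shift_inequality_PiM:
  fixes \<psi> :: "('i \<Rightarrow> real) \<Rightarrow> real"
  assumes I: "finite I" and \<tau>: "\<tau> > 0"
    and \<psi>: "\<psi> \<in> borel_measurable (\<Pi>\<^sub>M i\<in>I. lborel)" and bnd: "\<And>x. \<bar>\<psi> x\<bar> \<le> b"
  defines "N \<equiv> density lborel (normal_density 0 \<tau>)"
  shows "exp ((\<integral>x. \<psi> x \<partial>(\<Pi>\<^sub>M i\<in>I. N)) - (\<Sum>i\<in>I. (a i)\<^sup>2) / (2 * \<tau>\<^sup>2))
    \<le> (\<integral>x. exp (\<psi> (\<lambda>i\<in>I. x i + a i)) \<partial>(\<Pi>\<^sub>M i\<in>I. N))"
  using I \<psi> bnd
proof (induction I arbitrary: \<psi> b)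
  case empty
  interpret N: prob_space N
    unfolding N_def by (rule prob_space_normal_density[OF \<tau>])
  interpret product_sigma_finite "\<lambda>_::'i. N" ..
  show ?case
    by (simp add: PiM_empty lebesgue_integral_count_space_finite)
next
  case (insert i I)
  interpret N: prob_space N
    unfolding N_def by (rule prob_space_normal_density[OF \<tau>])
  interpret product_sigma_finite "\<lambda>_::'i. N" ..
  have [measurable_cong]: "sets N = sets borel"
    by (simp add: N_def)
  have [measurable_cong]: "sets (\<Pi>\<^sub>M i\<in>J. N) = sets (\<Pi>\<^sub>M i\<in>J. lborel)" for J :: "'i set"
    by (intro sets_PiM_cong) (auto simp: N_def)
  interpret P: prob_space "\<Pi>\<^sub>M i\<in>I. N"
    by (intro prob_space_PiM N.prob_space_axioms)
  interpret P': prob_space "\<Pi>\<^sub>M i\<in>insert i I. N"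
    by (intro prob_space_PiM N.prob_space_axioms)
  note [measurable] = insert.prems(1)
  have [measurable]: "(\<lambda>x. \<lambda>k\<in>J. x k + a k) \<in> (\<Pi>\<^sub>M i\<in>J. lborel) \<rightarrow>\<^sub>M (\<Pi>\<^sub>M i\<in>J. lborel)" for J
    by measurable
  have upd: "(\<lambda>(x, y). x(i := y)) \<in> (\<Pi>\<^sub>M i\<in>I. lborel) \<Otimes>\<^sub>M borel \<rightarrow>\<^sub>M (\<Pi>\<^sub>M i\<in>insert i I. lborel)"
    using measurable_add_dim[of i I "\<lambda>_. lborel"] by simp
  have upd': "(\<lambda>y. x(i := y)) \<in> borel \<rightarrow>\<^sub>M (\<Pi>\<^sub>M i\<in>insert i I. lborel)"
    if "x \<in> space (\<Pi>\<^sub>M i\<in>I. lborel)" for x :: "'i \<Rightarrow> real"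
    using measurable_component_update[of x I "\<lambda>_. lborel" i] that insert.hyps by simp
  \<comment> \<open>The exponent that the one-dimensional inequality yields in coordinate
    \<open>i\<close>, as a function of the other coordinates; the induction hypothesis is applied to
    it.\<close>
  define \<psi>' where "\<psi>' = (\<lambda>x. (\<integral>y. \<psi> (x(i := y)) \<partial>N) - (a i)\<^sup>2 / (2 * \<tau>\<^sup>2))"
  have \<psi>_upd [measurable]: "(\<lambda>(x, y). \<psi> (x(i := y))) \<in> borel_measurable ((\<Pi>\<^sub>M i\<in>I. lborel) \<Otimes>\<^sub>M borel)"
    using measurable_compose[OF upd insert.prems(1)] by (simp add: case_prod_beta')
  have \<psi>'_meas [measurable]: "\<psi>' \<in> borel_measurable (\<Pi>\<^sub>M i\<in>I. lborel)"
    unfolding \<psi>'_def by measurable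
  have \<psi>'_bnd: "\<bar>\<psi>' x\<bar> \<le> b + (a i)\<^sup>2 / (2 * \<tau>\<^sup>2)" for x
  proof -
    have "\<bar>\<integral>y. \<psi> (x(i := y)) \<partial>N\<bar> \<le> b"
    \<comment> \<open>The bound is claimed for all \<open>x\<close>, also outside the product space,
      where the section need not be integrable. The integral then has the default value 0.\<close>
    proof (cases "integrable N (\<lambda>y. \<psi> (x(i := y)))")
      case True
      have "\<bar>\<integral>y. \<psi> (x(i := y)) \<partial>N\<bar> \<le> (\<integral>y. \<bar>\<psi> (x(i := y))\<bar> \<partial>N)"
        by (rule integral_abs_bound)
      also have "\<dots> \<le> (\<integral>y. b \<partial>N)"
        using True insert.prems(2) by (intro integral_mono) auto
      finally show ?thesis by (simp add: N.prob_space)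
    next
      case False
      have "0 \<le> b"
        using insert.prems(2)[of undefined] by linarith
      thus ?thesis
        using False by (simp add: not_integrable_integral_eq)
    qed
    moreover have "0 \<le> (a i)\<^sup>2 / (2 * \<tau>\<^sup>2)"
      by simp
    ultimately show ?thesis
      unfolding \<psi>'_def by linarith
  qed
  have b_exp: "\<bar>exp (\<psi> x)\<bar> \<le> exp b" for x
    using insert.prems(2)[of x] by auto
  have int_exp: "integrable (\<Pi>\<^sub>M i\<in>insert i I. N) (\<lambda>x. exp (\<psi> (\<lambda>k\<in>insert i I. x k + a k)))"
    by (rule P'.integrable_const_bound[of _ "exp b"]) (use b_exp in auto)
  have int_\<psi>: "integrable (\<Pi>\<^sub>M i\<in>insert i I. N) \<psi>"
    by (rule P'.integrable_const_bound[of _ b]) (use insert.prems(2) in auto)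
  have int_\<psi>': "integrable (\<Pi>\<^sub>M i\<in>I. N) (\<lambda>x. \<integral>y. \<psi> (x(i := y)) \<partial>N)"
  proof -
    have "integrable (\<Pi>\<^sub>M i\<in>I. N) \<psi>'"
      by (rule P.integrable_const_bound) (auto intro!: \<psi>'_bnd AE_I2)
    hence "integrable (\<Pi>\<^sub>M i\<in>I. N) (\<lambda>x. \<psi>' x + (a i)\<^sup>2 / (2 * \<tau>\<^sup>2))"
      by (intro Bochner_Integration.integrable_add) auto
    thus ?thesis
      by (simp add: \<psi>'_def)
  qed
  have rsum: "(\<lambda>k\<in>insert i I. (x(i := y)) k + a k) = (\<lambda>k\<in>I. x k + a k)(i := y + a i)" for x y
    using insert.hyps by (auto simp: fun_eq_iff)
  have "(\<integral>x. \<psi> x \<partial>(\<Pi>\<^sub>M i\<in>insert i I. N)) = (\<integral>x. \<integral>y. \<psi> (x(i := y)) \<partial>N \<partial>(\<Pi>\<^sub>M i\<in>I. N))"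
    by (rule product_integral_insert[OF insert.hyps int_\<psi>])
  hence "exp ((\<integral>x. \<psi> x \<partial>(\<Pi>\<^sub>M i\<in>insert i I. N)) - (\<Sum>i\<in>insert i I. (a i)\<^sup>2) / (2 * \<tau>\<^sup>2))
      = exp ((\<integral>x. \<psi>' x \<partial>(\<Pi>\<^sub>M i\<in>I. N)) - (\<Sum>i\<in>I. (a i)\<^sup>2) / (2 * \<tau>\<^sup>2))"
    using int_\<psi>' insert.hyps by (simp add: \<psi>'_def P.prob_space add_divide_distrib algebra_simps)
  also have "\<dots> \<le> (\<integral>x. exp (\<psi>' (\<lambda>k\<in>I. x k + a k)) \<partial>(\<Pi>\<^sub>M i\<in>I. N))"
    by (rule insert.IH[OF \<psi>'_meas \<psi>'_bnd])
  \<comment> \<open>The one-dimensional inequality in coordinate \<open>i\<close>, with the other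
    coordinates already shifted.\<close>
  also have "\<dots> \<le> (\<integral>x. \<integral>y. exp (\<psi> (\<lambda>k\<in>insert i I. (x(i := y)) k + a k)) \<partial>N \<partial>(\<Pi>\<^sub>M i\<in>I. N))"
  proof (rule integral_mono)
    show "integrable (\<Pi>\<^sub>M i\<in>I. N) (\<lambda>x. exp (\<psi>' (\<lambda>k\<in>I. x k + a k)))"
    proof (rule P.integrable_const_bound)
      show "AE x in \<Pi>\<^sub>M i\<in>I. N. norm (exp (\<psi>' (\<lambda>k\<in>I. x k + a k))) \<le> exp (b + (a i)\<^sup>2 / (2 * \<tau>\<^sup>2))"
        using abs_le_D1[OF \<psi>'_bnd] by (intro AE_I2) simp
    qed measurable
    have m: "(\<lambda>x. \<integral>y. exp (\<psi> ((\<lambda>k\<in>I. x k + a k)(i := y + a i))) \<partial>N) \<in> borel_measurable (\<Pi>\<^sub>M i\<in>I. N)"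
    proof (rule N.borel_measurable_lebesgue_integral)
      have "(\<lambda>(x, y). ((\<lambda>k\<in>I. x k + a k), y + a i)) \<in> (\<Pi>\<^sub>M i\<in>I. N) \<Otimes>\<^sub>M N \<rightarrow>\<^sub>M (\<Pi>\<^sub>M i\<in>I. lborel) \<Otimes>\<^sub>M borel"
        by measurable
      from measurable_compose[OF this \<psi>_upd]
      show "case_prod (\<lambda>x y. exp (\<psi> ((\<lambda>k\<in>I. x k + a k)(i := y + a i)))) \<in> borel_measurable ((\<Pi>\<^sub>M i\<in>I. N) \<Otimes>\<^sub>M N)"
        by (simp add: case_prod_beta')
    qed
    show "integrable (\<Pi>\<^sub>M i\<in>I. N) (\<lambda>x. \<integral>y. exp (\<psi> (\<lambda>k\<in>insert i I. (x(i := y)) k + a k)) \<partial>N)"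
    proof (rule P.integrable_const_bound)
      have "(\<integral>y. exp (\<psi> (\<lambda>k\<in>insert i I. (x(i := y)) k + a k)) \<partial>N) \<le> (\<integral>y. exp b \<partial>N)" for x
        by (rule integral_mono') (use insert.prems(2) abs_le_D1 in auto)
      thus "AE x in \<Pi>\<^sub>M i\<in>I. N. norm (\<integral>y. exp (\<psi> (\<lambda>k\<in>insert i I. (x(i := y)) k + a k)) \<partial>N) \<le> exp b"
        by (intro AE_I2) (simp add: N.prob_space)
    qed (use m in \<open>simp only: rsum\<close>)
    fix x assume x: "x \<in> space (\<Pi>\<^sub>M i\<in>I. N)"
    let ?z = "\<lambda>k\<in>I. x k + a k"
    have "?z \<in> space (\<Pi>\<^sub>M i\<in>I. lborel)"
      by (auto simp: space_PiM)
    hence "(\<lambda>y. \<psi> (?z(i := y))) \<in> borel_measurable borel"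
      using measurable_compose[OF upd' insert.prems(1)] by simp
    from gaussian_shift_inequality[OF this _ \<tau>, of b "a i"]
    show "exp (\<psi>' ?z) \<le> (\<integral>y. exp (\<psi> (\<lambda>k\<in>insert i I. (x(i := y)) k + a k)) \<partial>N)"
      unfolding rsum using insert.prems(2) by (simp add: \<psi>'_def N_def)
  qed
  also have "\<dots> = (\<integral>x. exp (\<psi> (\<lambda>k\<in>insert i I. x k + a k)) \<partial>(\<Pi>\<^sub>M i\<in>insert i I. N))"
    by (rule product_integral_insert[OF insert.hyps int_exp, symmetric])
  finally show ?case .
qed

section \<open>Changing the target of noisy gradient descent\<close>

lemma sets_gaussian_noise [measurable_cong]: "sets (gaussian_noise p \<tau>) = sets (param_space p)"
  unfolding gaussian_noise_def param_space_def by (intro sets_PiM_cong) auto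

lemma prob_space_gaussian_noise: "\<tau> > 0 \<Longrightarrow> prob_space (gaussian_noise p \<tau>)"
  unfolding gaussian_noise_def by (intro prob_space_PiM prob_space_normal_density)

lemma measurable_param_spaceI:
  assumes "\<And>i. i < p \<Longrightarrow> (\<lambda>x. F x i) \<in> borel_measurable M"
  shows "(\<lambda>x. \<lambda>i\<in>{..<p}. F x i) \<in> M \<rightarrow>\<^sub>M param_space p"
  unfolding param_space_def using assms by (intro measurable_restrict) auto

lemma measurable_param_component:
  "i < p \<Longrightarrow> (\<lambda>\<theta>. \<theta> i) \<in> borel_measurable (param_space p)"
  unfolding param_space_def by simp

lemma L2_set_proj_ball_le:
  assumes "R \<ge> 0"
  shows "L2_set (proj_ball p R v) {..<p} \<le> R"
proof (cases "L2_set v {..<p} \<le> R")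
  case False
  have "L2_set (proj_ball p R v) {..<p} = L2_set (\<lambda>i. R / L2_set v {..<p} * v i) {..<p}"
    using False unfolding proj_ball_def by (intro L2_set_cong) auto
  also have "\<dots> = R / L2_set v {..<p} * L2_set v {..<p}"
    using assms by (intro L2_set_right_distrib[symmetric]) (simp add: L2_set_nonneg)
  finally show ?thesis
    using False assms by simp
qed (simp add: proj_ball_def)

lemma sum_proj_ball_sq_le:
  assumes "R \<ge> 0"
  shows "(\<Sum>i<p. (proj_ball p R v i)\<^sup>2) \<le> R\<^sup>2"
  using L2_set_proj_ball_le[OF assms, of p v] unfolding L2_set_def
  by (simp add: sqrt_le_D)

lemma abs_proj_ball_le:
  assumes "R \<ge> 0" "i < p"
  shows "\<bar>proj_ball p R v i\<bar> \<le> R"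
proof -
  have "(proj_ball p R v i)\<^sup>2 \<le> (\<Sum>i<p. (proj_ball p R v i)\<^sup>2)"
    using assms by (intro member_le_sum) auto
  also have "\<dots> \<le> R\<^sup>2"
    by (rule sum_proj_ball_sq_le[OF assms(1)])
  finally show ?thesis
    using assms(1) by (metis abs_le_square_iff abs_of_nonneg)
qed

lemma measurable_proj_ball:
  assumes "G \<in> M \<rightarrow>\<^sub>M param_space p" "i < p"
  shows "(\<lambda>x. proj_ball p R (G x) i) \<in> borel_measurable M"
proof -
  have [measurable]: "(\<lambda>x. G x j) \<in> borel_measurable M" if "j < p" for j
    using measurable_compose[OF assms(1) measurable_param_component[OF that]] .
  have [measurable]: "(\<lambda>x. L2_set (G x) {..<p}) \<in> borel_measurable M"
    unfolding L2_set_def by measurable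
  have "(\<lambda>x. proj_ball p R (G x) i) =
      (\<lambda>x. if L2_set (G x) {..<p} \<le> R then G x i else R / L2_set (G x) {..<p} * G x i)"
    using assms(2) by (auto simp: proj_ball_def fun_eq_iff)
  also have "\<dots> \<in> borel_measurable M"
    using assms(2) by measurable
  finally show ?thesis .
qed

text \<open>Fixes a single \<open>d\<close>, so that all estimates up to the last theorem are
  non-asymptotic. The target, the initial parameters and the number of steps stay variable, because
  runs with two targets are compared by induction on the steps.\<close>

locale training =
  fixes X p :: nat and R \<tau> :: real
    and f :: "nat \<Rightarrow> (nat \<Rightarrow> real) \<Rightarrow> real"
    and g :: "nat \<Rightarrow> (nat \<Rightarrow> real) \<Rightarrow> nat \<Rightarrow> real"
    and \<eta> :: "nat \<Rightarrow> real"
  assumes model: "param_model X p f g"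
    and R_nonneg: "R \<ge> 0" and \<tau>_pos: "\<tau> > 0"
begin

abbreviation "G \<equiv> pop_gradient X p R f g"
abbreviation "gd \<equiv> noisy_gd X p R f g \<eta>"
abbreviation "noise \<equiv> gaussian_noise p \<tau>"
abbreviation "noises T \<equiv> \<Pi>\<^sub>M k\<in>{..<T::nat}. noise"

sublocale noise: prob_space noise
  by (rule prob_space_gaussian_noise[OF \<tau>_pos])

lemma prob_space_noises: "prob_space (noises T)"
  by (intro prob_space_PiM noise.prob_space_axioms)

text \<open>The model's own output cancels. What remains is a correlation of \<open>h - h'\<close>
  with a clipped gradient that does not involve the targets, the form that
  \<open>cross_predictability\<close> handles.\<close>

lemma pop_gradient_diff:
  "i < p \<Longrightarrow> G h \<theta> i - G h' \<theta> i = - avg X (\<lambda>n. proj_ball p R (g n \<theta>) i * (h n - h' n))"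
  by (simp add: pop_gradient_def avg_eq_sum diff_divide_distrib sum_subtractf algebra_simps)

lemma measurable_pop_gradient:
  assumes "i < p"
  shows "(\<lambda>\<theta>. G h \<theta> i) \<in> borel_measurable (param_space p)"
proof -
  have [measurable]: "f n \<in> borel_measurable (param_space p)"
    "(\<lambda>\<theta>. proj_ball p R (g n \<theta>) i) \<in> borel_measurable (param_space p)" if "n \<in> {1..X}" for n
    using model that assms by (auto simp: param_model_def intro: measurable_proj_ball)
  show ?thesis
    using assms by (simp add: pop_gradient_def avg_eq_sum)
qed

text \<open>The relative entropy which one noisy step with target \<open>h'\<close> has with respect to target \<open>h\<close>.\<close>

definition step_cost :: "(nat \<Rightarrow> real) \<Rightarrow> (nat \<Rightarrow> real) \<Rightarrow> (nat \<Rightarrow> real) \<Rightarrow> real" where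
  "step_cost h h' \<theta> = (\<Sum>i<p. (G h \<theta> i - G h' \<theta> i)\<^sup>2) / (2 * \<tau>\<^sup>2)"

lemma step_cost_nonneg: "step_cost h h' \<theta> \<ge> 0"
  unfolding step_cost_def by (simp add: sum_nonneg)

lemma measurable_step_cost [measurable]: "step_cost h h' \<in> borel_measurable (param_space p)"
  unfolding step_cost_def using measurable_pop_gradient
  by (intro borel_measurable_divide borel_measurable_sum borel_measurable_power borel_measurable_diff)
    auto

text \<open>Clipping gives a bound uniform in the parameters. It serves integrability only; the
  quantitative bound comes from averaging over the targets.\<close>

lemma step_cost_bounded: "\<exists>B. \<forall>\<theta>. step_cost h h' \<theta> \<le> B"
proof (intro exI allI)
  fix \<theta>
  show "step_cost h h' \<theta> \<le> (\<Sum>i<p. (avg X (\<lambda>n. R * \<bar>h n - h' n\<bar>))\<^sup>2) / (2 * \<tau>\<^sup>2)"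
    unfolding step_cost_def
  proof (intro divide_right_mono sum_mono)
    fix i assume "i \<in> {..<p}"
    hence i: "i < p" by simp
    have "\<bar>G h \<theta> i - G h' \<theta> i\<bar> \<le> (\<Sum>n\<in>{1..X}. \<bar>proj_ball p R (g n \<theta>) i * (h n - h' n)\<bar>) / X"
      unfolding pop_gradient_diff[OF i] avg_eq_sum by (simp add: divide_right_mono)
    also have "\<dots> \<le> avg X (\<lambda>n. R * \<bar>h n - h' n\<bar>)"
      unfolding avg_eq_sum
      by (intro divide_right_mono sum_mono)
        (auto simp: abs_mult intro!: mult_right_mono abs_proj_ball_le R_nonneg i)
    finally show "(G h \<theta> i - G h' \<theta> i)\<^sup>2 \<le> (avg X (\<lambda>n. R * \<bar>h n - h' n\<bar>))\<^sup>2"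
      by (metis abs_ge_zero power_mono power2_abs)
  qed simp
qed

section \<open>A single update, and measurability of the run\<close>

definition gd_step :: "(nat \<Rightarrow> real) \<Rightarrow> nat \<Rightarrow> (nat \<Rightarrow> real) \<Rightarrow> (nat \<Rightarrow> real) \<Rightarrow> nat \<Rightarrow> real" where
  "gd_step h k \<theta> y = (\<lambda>i\<in>{..<p}. \<theta> i - \<eta> k * (G h \<theta> i + y i))"

lemma gd_Suc: "gd h \<theta>0 \<xi> (Suc k) = gd_step h k (gd h \<theta>0 \<xi> k) (\<xi> k)"
  by (simp add: gd_step_def Let_def)

text \<open>The run is adapted to the noise: the parameters after \<open>k\<close> steps read only
  the noise of the steps below \<open>k\<close>, so index \<open>T\<close> is not among them even
  for \<open>k = T\<close>.\<close>

lemma gd_upd: "k \<le> T \<Longrightarrow> gd h \<theta>0 (\<xi>(T := y)) k = gd h \<theta>0 \<xi> k"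
  by (induction k) auto

lemma measurable_gd_step [measurable]:
  "(\<lambda>(\<theta>, y). gd_step h k \<theta> y) \<in> param_space p \<Otimes>\<^sub>M param_space p \<rightarrow>\<^sub>M param_space p"
  unfolding gd_step_def case_prod_beta'
proof (rule measurable_param_spaceI)
  fix i assume "i < p"
  note [measurable] = measurable_pop_gradient[OF this, of h] measurable_param_component[OF this]
  show "(\<lambda>x. fst x i - \<eta> k * (G h (fst x) i + snd x i)) \<in> borel_measurable (param_space p \<Otimes>\<^sub>M param_space p)"
    by measurable
qed

text \<open>Here \<open>\<theta>\<close> is an arbitrary function, possibly outside the parameter
  space, so this is not a section of the joint statement above.\<close>

lemma measurable_gd_step_noise: "gd_step h k \<theta> \<in> param_space p \<rightarrow>\<^sub>M param_space p"
  unfolding gd_step_def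
proof (rule measurable_param_spaceI)
  fix i assume "i < p"
  note [measurable] = measurable_param_component[OF this]
  show "(\<lambda>y. \<theta> i - \<eta> k * (G h \<theta> i + y i)) \<in> borel_measurable (param_space p)"
    by measurable
qed

lemma measurable_gd [measurable (raw)]:
  assumes "\<theta>0 \<in> space (param_space p)" "k \<le> T"
  shows "(\<lambda>\<xi>. gd h \<theta>0 \<xi> k) \<in> noises T \<rightarrow>\<^sub>M param_space p"
  using assms(2)
proof (induction k)
  case 0
  show ?case using assms(1) by simp
next
  case (Suc k)
  have "(\<lambda>\<xi>. \<xi> k) \<in> noises T \<rightarrow>\<^sub>M noise"
    using Suc.prems by simp
  hence "(\<lambda>\<xi>. (gd h \<theta>0 \<xi> k, \<xi> k)) \<in> noises T \<rightarrow>\<^sub>M param_space p \<Otimes>\<^sub>M param_space p"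
    using Suc measurable_cong_sets[OF refl sets_gaussian_noise] by (intro measurable_Pair) auto
  from measurable_compose[OF this measurable_gd_step] show ?case
    unfolding gd_Suc by (simp add: case_prod_beta')
qed

text \<open>Adding the gradient difference to the noise turns a step with target \<open>h'\<close>
  into one with target \<open>h\<close>. The step size multiplies gradient and noise alike and so
  does not enter the cost.\<close>

lemma one_step_change_of_target:
  assumes \<Phi>: "\<Phi> \<in> borel_measurable (param_space p)" and bnd: "\<And>\<theta>. \<bar>\<Phi> \<theta>\<bar> \<le> b"
  shows "exp ((\<integral>y. \<Phi> (gd_step h' k \<theta> y) \<partial>noise) - step_cost h h' \<theta>)
    \<le> (\<integral>y. exp (\<Phi> (gd_step h k \<theta> y)) \<partial>noise)"
proof -
  let ?a = "\<lambda>i. G h \<theta> i - G h' \<theta> i"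
  have "gd_step h' k \<theta> (\<lambda>i\<in>{..<p}. y i + ?a i) = gd_step h k \<theta> y" for y
    by (auto simp: gd_step_def fun_eq_iff)
  moreover have "(\<lambda>y. \<Phi> (gd_step h' k \<theta> y)) \<in> borel_measurable (\<Pi>\<^sub>M i\<in>{..<p}. lborel)"
    using measurable_compose[OF measurable_gd_step_noise \<Phi>] by (simp add: param_space_def)
  from gaussian_shift_inequality_PiM[OF finite_lessThan \<tau>_pos this, of b ?a]
  have "exp ((\<integral>y. \<Phi> (gd_step h' k \<theta> y) \<partial>noise) - step_cost h h' \<theta>)
    \<le> (\<integral>y. exp (\<Phi> (gd_step h' k \<theta> (\<lambda>i\<in>{..<p}. y i + ?a i))) \<partial>noise)"
    using bnd by (simp add: step_cost_def gaussian_noise_def)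
  ultimately show ?thesis by simp
qed

text \<open>
  This is the Donsker--Varadhan lower bound for the law of the parameters, with the relative
  entropy written out by the chain rule.
\<close>

lemma change_of_target:
  assumes \<theta>0: "\<theta>0 \<in> space (param_space p)"
    and \<Phi>: "\<Phi> \<in> borel_measurable (param_space p)" and bnd: "\<And>\<theta>. \<bar>\<Phi> \<theta>\<bar> \<le> b"
  shows "exp (\<integral>\<xi>. \<Phi> (gd h' \<theta>0 \<xi> T) - (\<Sum>k<T. step_cost h h' (gd h' \<theta>0 \<xi> k)) \<partial>noises T)
    \<le> (\<integral>\<xi>. exp (\<Phi> (gd h \<theta>0 \<xi> T)) \<partial>noises T)"
  using \<Phi> bnd
proof (induction T arbitrary: \<Phi> b)
  case 0
  show ?case
    by (simp add: PiM_empty lebesgue_integral_count_space_finite)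
next
  case (Suc T)
  note [measurable] = Suc.prems(1) measurable_gd_step_noise
  interpret product_sigma_finite "\<lambda>_::nat. noise" ..
  interpret P: prob_space "noises T"
    by (rule prob_space_noises)
  interpret P': prob_space "noises (Suc T)"
    by (rule prob_space_noises)
  obtain B where B: "step_cost h h' \<theta> \<le> B" for \<theta>
    using step_cost_bounded by blast
  define c where "c = step_cost h h'"
  have [measurable]: "c \<in> borel_measurable (param_space p)"
    by (simp add: c_def)
  have c_abs: "\<bar>c \<theta>\<bar> \<le> B" for \<theta>
    using B step_cost_nonneg by (simp add: c_def)
  have gd_meas [measurable]: "(\<lambda>\<xi>. gd h'' \<theta>0 \<xi> k) \<in> noises S \<rightarrow>\<^sub>M param_space p" if "k \<le> S" for h'' k S
    using measurable_gd[OF \<theta>0 that] .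
  \<comment> \<open>Backward recursion: the last step of the run on \<open>h\<close> is folded into
    the test function, leaving a run of \<open>T\<close> steps for the induction hypothesis.\<close>
  define \<Phi>' where "\<Phi>' = (\<lambda>\<theta>. ln (\<integral>y. exp (\<Phi> (gd_step h T \<theta> y)) \<partial>noise))"
  have exp_bnd: "exp (-b) \<le> exp (\<Phi> \<theta>)" "exp (\<Phi> \<theta>) \<le> exp b" for \<theta>
    using Suc.prems(2)[of \<theta>] by auto
  have int_exp: "integrable noise (\<lambda>y. exp (\<Phi> (gd_step h T \<theta> y)))" for \<theta>
    by (rule noise.integrable_const_bound[of _ "exp b"]) (auto simp: abs_le_D1[OF Suc.prems(2)])
  \<comment> \<open>This lower bound keeps the logarithm bounded, so that \<open>\<Phi>'\<close> is
    again an admissible test function.\<close>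
  have int_ge: "exp (-b) \<le> (\<integral>y. exp (\<Phi> (gd_step h T \<theta> y)) \<partial>noise)" for \<theta>
    using integral_mono[of noise "\<lambda>_. exp (-b)", OF _ int_exp exp_bnd(1)] by (simp add: noise.prob_space)
  have int_le: "(\<integral>y. exp (\<Phi> (gd_step h T \<theta> y)) \<partial>noise) \<le> exp b" for \<theta>
    using integral_mono[of noise _ "\<lambda>_. exp b", OF int_exp _ exp_bnd(2)] by (simp add: noise.prob_space)
  have int_pos: "0 < (\<integral>y. exp (\<Phi> (gd_step h T \<theta> y)) \<partial>noise)" for \<theta>
    using int_ge[of \<theta>] exp_gt_zero[of "-b"] by linarith
  have \<Phi>'_meas [measurable]: "\<Phi>' \<in> borel_measurable (param_space p)"
    unfolding \<Phi>'_def by measurable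
  have \<Phi>'_bnd: "\<bar>\<Phi>' \<theta>\<bar> \<le> b" for \<theta>
  proof -
    have "\<Phi>' \<theta> \<le> b"
      using int_le[of \<theta>] int_pos[of \<theta>] unfolding \<Phi>'_def by (metis exp_gt_zero ln_exp ln_le_cancel_iff)
    moreover have "-b \<le> \<Phi>' \<theta>"
      using int_ge[of \<theta>] int_pos[of \<theta>] unfolding \<Phi>'_def by (metis exp_gt_zero ln_exp ln_le_cancel_iff)
    ultimately show ?thesis by simp
  qed
  have step: "(\<integral>y. \<Phi> (gd_step h' T \<theta> y) \<partial>noise) - c \<theta> \<le> \<Phi>' \<theta>" for \<theta>
    using one_step_change_of_target[OF Suc.prems, of h' T \<theta> h] int_pos[of \<theta>]
    by (simp add: \<Phi>'_def c_def ln_ge_iff)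
  have int_step: "\<bar>\<integral>y. \<Phi> (gd_step h' T \<theta> y) \<partial>noise\<bar> \<le> b" for \<theta>
  proof -
    have "integrable noise (\<lambda>y. \<bar>\<Phi> (gd_step h' T \<theta> y)\<bar>)"
      by (rule noise.integrable_const_bound[of _ b]) (auto simp: Suc.prems(2))
    hence "(\<integral>y. \<bar>\<Phi> (gd_step h' T \<theta> y)\<bar> \<partial>noise) \<le> (\<integral>y. b \<partial>noise)"
      by (intro integral_mono) (auto simp: Suc.prems(2))
    thus ?thesis
      by (intro order_trans[OF integral_abs_bound]) (simp add: noise.prob_space)
  qed
  have csum: "\<bar>\<Sum>k<S. c (gd h' \<theta>0 \<xi> k)\<bar> \<le> S * B" for S \<xi>
    using order_trans[OF sum_abs sum_bounded_above[of "{..<S}" "\<lambda>k. \<bar>c (gd h' \<theta>0 \<xi> k)\<bar>" B]] c_abs by simp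
  have csum_meas [measurable]: "(\<lambda>\<xi>. \<Sum>k<S. c (gd h' \<theta>0 \<xi> k)) \<in> borel_measurable (noises S')" if "S \<le> S'" for S S'
    using that by (intro borel_measurable_sum measurable_compose[OF gd_meas]) auto
  have integral_Suc: "(\<integral>\<xi>. F \<xi> \<partial>noises (Suc T)) = (\<integral>\<xi>. \<integral>y. F (\<xi>(T := y)) \<partial>noise \<partial>noises T)"
    if "integrable (noises (Suc T)) F" for F :: "(nat \<Rightarrow> nat \<Rightarrow> real) \<Rightarrow> real"
    using product_integral_insert[of "{..<T}" T F] that by (simp add: lessThan_Suc)
  have int_lhs: "integrable (noises (Suc T)) (\<lambda>\<xi>. \<Phi> (gd h' \<theta>0 \<xi> (Suc T)) - (\<Sum>k<Suc T. c (gd h' \<theta>0 \<xi> k)))"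
  proof (rule P'.integrable_const_bound)
    show "AE \<xi> in noises (Suc T). norm (\<Phi> (gd h' \<theta>0 \<xi> (Suc T)) - (\<Sum>k<Suc T. c (gd h' \<theta>0 \<xi> k))) \<le> b + Suc T * B"
      using abs_triangle_ineq4[THEN order_trans, OF add_mono[OF Suc.prems(2) csum]]
      unfolding real_norm_def by (intro AE_I2) blast
    show "(\<lambda>\<xi>. \<Phi> (gd h' \<theta>0 \<xi> (Suc T)) - (\<Sum>k<Suc T. c (gd h' \<theta>0 \<xi> k))) \<in> borel_measurable (noises (Suc T))"
      by (intro borel_measurable_diff measurable_compose[OF gd_meas Suc.prems(1)] csum_meas) auto
  qed
  have int_rhs: "integrable (noises (Suc T)) (\<lambda>\<xi>. exp (\<Phi> (gd h \<theta>0 \<xi> (Suc T))))"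
    by (rule P'.integrable_const_bound[of _ "exp b"])
      (auto simp del: noisy_gd.simps simp: abs_le_D1[OF Suc.prems(2)] intro: measurable_compose[OF gd_meas Suc.prems(1)]
        intro!: borel_measurable_exp[THEN measurable_compose_rev])
  have "(\<integral>\<xi>. \<Phi> (gd h' \<theta>0 \<xi> (Suc T)) - (\<Sum>k<Suc T. c (gd h' \<theta>0 \<xi> k)) \<partial>noises (Suc T))
      = (\<integral>\<xi>. \<integral>y. \<Phi> (gd h' \<theta>0 (\<xi>(T := y)) (Suc T)) - (\<Sum>k<Suc T. c (gd h' \<theta>0 (\<xi>(T := y)) k)) \<partial>noise \<partial>noises T)"
    by (rule integral_Suc[OF int_lhs])
  \<comment> \<open>Even the cost of step \<open>T\<close> is evaluated before that step's noise is
    drawn, so the whole sum of costs leaves the inner integral.\<close>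
  also have "\<dots> = (\<integral>\<xi>. (\<integral>y. \<Phi> (gd_step h' T (gd h' \<theta>0 \<xi> T) y) \<partial>noise) - (\<Sum>k<Suc T. c (gd h' \<theta>0 \<xi> k)) \<partial>noises T)"
  proof (rule Bochner_Integration.integral_cong)
    fix \<xi>
    have "(\<integral>y. \<Phi> (gd h' \<theta>0 (\<xi>(T := y)) (Suc T)) - (\<Sum>k<Suc T. c (gd h' \<theta>0 (\<xi>(T := y)) k)) \<partial>noise)
      = (\<integral>y. \<Phi> (gd_step h' T (gd h' \<theta>0 \<xi> T) y) - (\<Sum>k<Suc T. c (gd h' \<theta>0 \<xi> k)) \<partial>noise)"
      by (simp only: gd_Suc gd_upd fun_upd_same order_refl) (simp add: gd_upd)
    also have "\<dots> = (\<integral>y. \<Phi> (gd_step h' T (gd h' \<theta>0 \<xi> T) y) \<partial>noise) - (\<Sum>k<Suc T. c (gd h' \<theta>0 \<xi> k))"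
    proof -
      have "integrable noise (\<lambda>y. \<Phi> (gd_step h' T (gd h' \<theta>0 \<xi> T) y))"
        by (rule noise.integrable_const_bound[of _ b]) (auto simp: Suc.prems(2))
      thus ?thesis by (simp add: noise.prob_space)
    qed
    finally show "(\<integral>y. \<Phi> (gd h' \<theta>0 (\<xi>(T := y)) (Suc T)) - (\<Sum>k<Suc T. c (gd h' \<theta>0 (\<xi>(T := y)) k)) \<partial>noise) = \<dots>" .
  qed simp
  \<comment> \<open>The one-step inequality absorbs the last cost into
    \<open>\<Phi>'\<close>.\<close>
  also have "\<dots> \<le> (\<integral>\<xi>. \<Phi>' (gd h' \<theta>0 \<xi> T) - (\<Sum>k<T. c (gd h' \<theta>0 \<xi> k)) \<partial>noises T)"
  proof (rule integral_mono)
    show "integrable (noises T) (\<lambda>\<xi>. (\<integral>y. \<Phi> (gd_step h' T (gd h' \<theta>0 \<xi> T) y) \<partial>noise) - (\<Sum>k<Suc T. c (gd h' \<theta>0 \<xi> k)))"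
    proof (rule P.integrable_const_bound)
      show "AE \<xi> in noises T. norm ((\<integral>y. \<Phi> (gd_step h' T (gd h' \<theta>0 \<xi> T) y) \<partial>noise) - (\<Sum>k<Suc T. c (gd h' \<theta>0 \<xi> k))) \<le> b + Suc T * B"
        using abs_triangle_ineq4[THEN order_trans, OF add_mono[OF int_step csum]]
        unfolding real_norm_def by (intro AE_I2) blast
      have m: "(\<lambda>\<theta>. \<integral>y. \<Phi> (gd_step h' T \<theta> y) \<partial>noise) \<in> borel_measurable (param_space p)"
        by measurable
      have "(\<lambda>\<xi>. \<Sum>k<Suc T. c (gd h' \<theta>0 \<xi> k)) \<in> borel_measurable (noises T)"
        by (intro borel_measurable_sum measurable_compose[OF gd_meas]) auto
      thus "(\<lambda>\<xi>. (\<integral>y. \<Phi> (gd_step h' T (gd h' \<theta>0 \<xi> T) y) \<partial>noise) - (\<Sum>k<Suc T. c (gd h' \<theta>0 \<xi> k))) \<in> borel_measurable (noises T)"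
        by (intro borel_measurable_diff measurable_compose[OF gd_meas m]) auto
    qed
    show "integrable (noises T) (\<lambda>\<xi>. \<Phi>' (gd h' \<theta>0 \<xi> T) - (\<Sum>k<T. c (gd h' \<theta>0 \<xi> k)))"
    proof (rule P.integrable_const_bound)
      show "AE \<xi> in noises T. norm (\<Phi>' (gd h' \<theta>0 \<xi> T) - (\<Sum>k<T. c (gd h' \<theta>0 \<xi> k))) \<le> b + T * B"
        using abs_triangle_ineq4[THEN order_trans, OF add_mono[OF \<Phi>'_bnd csum]]
        unfolding real_norm_def by (intro AE_I2) blast
      show "(\<lambda>\<xi>. \<Phi>' (gd h' \<theta>0 \<xi> T) - (\<Sum>k<T. c (gd h' \<theta>0 \<xi> k))) \<in> borel_measurable (noises T)"
        by (intro borel_measurable_diff measurable_compose[OF gd_meas \<Phi>'_meas] csum_meas) auto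
    qed
    fix \<xi>
    show "(\<integral>y. \<Phi> (gd_step h' T (gd h' \<theta>0 \<xi> T) y) \<partial>noise) - (\<Sum>k<Suc T. c (gd h' \<theta>0 \<xi> k))
        \<le> \<Phi>' (gd h' \<theta>0 \<xi> T) - (\<Sum>k<T. c (gd h' \<theta>0 \<xi> k))"
      using step[of "gd h' \<theta>0 \<xi> T"] by simp
  qed
  finally have "exp (\<integral>\<xi>. \<Phi> (gd h' \<theta>0 \<xi> (Suc T)) - (\<Sum>k<Suc T. c (gd h' \<theta>0 \<xi> k)) \<partial>noises (Suc T))
      \<le> exp (\<integral>\<xi>. \<Phi>' (gd h' \<theta>0 \<xi> T) - (\<Sum>k<T. c (gd h' \<theta>0 \<xi> k)) \<partial>noises T)"
    by simp
  also have "\<dots> \<le> (\<integral>\<xi>. exp (\<Phi>' (gd h \<theta>0 \<xi> T)) \<partial>noises T)"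
    unfolding c_def by (rule Suc.IH[OF \<Phi>'_meas \<Phi>'_bnd])
  also have "\<dots> = (\<integral>\<xi>. \<integral>y. exp (\<Phi> (gd h \<theta>0 (\<xi>(T := y)) (Suc T))) \<partial>noise \<partial>noises T)"
    by (simp only: gd_Suc gd_upd fun_upd_same order_refl) (simp add: \<Phi>'_def int_pos)
  also have "\<dots> = (\<integral>\<xi>. exp (\<Phi> (gd h \<theta>0 \<xi> (Suc T))) \<partial>noises (Suc T))"
    by (rule integral_Suc[OF int_rhs, symmetric])
  finally show ?case
    unfolding c_def .
qed

end

section \<open>The probability of success\<close>

text \<open>With \<open>u\<close> the predictor minus the indicator, \<open>S\<close> its mean
  square and \<open>W h\<close> its correlation with \<open>h\<close> minus the indicator, success
  means \<open>S + L \<le> 2 * W h\<close>. Since \<open>(S + L)\<^sup>2 \<ge> 4 * L * S\<close>,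
  this forces \<open>(W h)\<^sup>2 \<ge> L * S\<close>. The mean of \<open>(W h)\<^sup>2\<close> is
  at most \<open>S / sqrt X\<close>, and \<open>S\<close> cancels in Chebyshev's inequality, so the
  bound is uniform in the predictor.\<close>

lemma fixed_predictor_success_le:
  fixes F :: "nat \<Rightarrow> real"
  assumes L: "L > 0"
  shows "(\<Sum>h\<in>mult_sign_funs X. of_bool ((l2norm X (\<lambda>n. F n - h n))\<^sup>2
        \<le> (l2norm X (\<lambda>n. h n - of_bool (is_square n)))\<^sup>2 - L))
    \<le> card (mult_sign_funs X) / (L * sqrt X)"
proof -
  define u where "u = (\<lambda>n. F n - of_bool (is_square n))"
  define W where "W = (\<lambda>h. avg X (\<lambda>n. u n * (h n - of_bool (is_square n))))"
  define S where "S = avg X (\<lambda>n. (u n)\<^sup>2)"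
  define P where "P = (\<lambda>h. (l2norm X (\<lambda>n. F n - h n))\<^sup>2
        \<le> (l2norm X (\<lambda>n. h n - of_bool (is_square n)))\<^sup>2 - L)"
  have S_nonneg: "S \<ge> 0"
    by (simp add: S_def avg_eq_sum sum_nonneg)
  have expand: "avg X (\<lambda>n. (F n - h n)\<^sup>2) = S - 2 * W h + avg X (\<lambda>n. (h n - of_bool (is_square n))\<^sup>2)" for h
  proof -
    have "(F n - h n)\<^sup>2 = (u n)\<^sup>2 - 2 * (u n * (h n - of_bool (is_square n))) + (h n - of_bool (is_square n))\<^sup>2" for n
      by (simp add: u_def power2_eq_square algebra_simps)
    thus ?thesis
      by (simp add: S_def W_def avg_eq_sum sum.distrib sum_subtractf add_divide_distrib
          diff_divide_distrib flip: sum_distrib_left)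
  qed
  have P_imp: "S + L \<le> 2 * W h" if "P h" for h
    using that unfolding P_def l2norm_sq expand by simp
  have W_sum: "(\<Sum>h\<in>mult_sign_funs X. (W h)\<^sup>2) \<le> card (mult_sign_funs X) * (S / sqrt X)"
    unfolding W_def S_def by (rule cross_predictability)
  have le: "of_bool (P h) * (L * S) \<le> (W h)\<^sup>2" for h
  proof (cases "P h")
    case True
    have "4 * (L * S) \<le> (S + L)\<^sup>2"
      using sum_squares_ge_zero[of "S - L" 0] by (simp add: power2_eq_square algebra_simps)
    also have "\<dots> \<le> (2 * W h)\<^sup>2"
      using P_imp[OF True] S_nonneg L by (intro power_mono) auto
    finally show ?thesis using True by simp
  qed simp
  have "(\<Sum>h\<in>mult_sign_funs X. of_bool (P h)) \<le> card (mult_sign_funs X) / (L * sqrt X)"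
  \<comment> \<open>When \<open>S\<close> cannot be cancelled, every \<open>W h\<close> vanishes and
    success would give \<open>L \<le> 0\<close>.\<close>
  proof (cases "S = 0")
    case True
    hence "(\<Sum>h\<in>mult_sign_funs X. (W h)\<^sup>2) = 0"
      using W_sum by (intro antisym sum_nonneg) auto
    hence "\<not> P h" if "h \<in> mult_sign_funs X" for h
      using that P_imp[of h] True L by (auto simp: sum_nonneg_eq_0_iff finite_mult_sign_funs)
    hence "(\<Sum>h\<in>mult_sign_funs X. of_bool (P h)) = (0::real)"
      by simp
    thus ?thesis
      using L by simp
  next
    case False
    have "(\<Sum>h\<in>mult_sign_funs X. of_bool (P h)) * (L * S) \<le> (\<Sum>h\<in>mult_sign_funs X. (W h)\<^sup>2)"
      unfolding sum_distrib_right by (intro sum_mono le)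
    also note W_sum
    also have "card (mult_sign_funs X) * (S / sqrt X) = card (mult_sign_funs X) / (L * sqrt X) * (L * S)"
      using L by simp
    finally show ?thesis
      using L False S_nonneg by (simp only: mult_le_cancel_right) auto
  qed
  thus ?thesis
    unfolding P_def .
qed

context training
begin

abbreviation sq :: "nat \<Rightarrow> real" where "sq n \<equiv> of_bool (is_square n)"

lemma sum_step_cost_le:
  "(\<Sum>h\<in>mult_sign_funs X. step_cost h sq \<theta>) \<le> card (mult_sign_funs X) * (R\<^sup>2 / (2 * \<tau>\<^sup>2 * sqrt X))"
proof -
  let ?M = "mult_sign_funs X"
  let ?v = "\<lambda>i n. proj_ball p R (g n \<theta>) i"
  have "(\<Sum>h\<in>?M. \<Sum>i<p. (G h \<theta> i - G sq \<theta> i)\<^sup>2) = (\<Sum>i<p. \<Sum>h\<in>?M. (G h \<theta> i - G sq \<theta> i)\<^sup>2)"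
    by (rule sum.swap)
  also have "\<dots> = (\<Sum>i<p. \<Sum>h\<in>?M. (avg X (\<lambda>n. ?v i n * (h n - sq n)))\<^sup>2)"
    by (simp add: pop_gradient_diff)
  also have "\<dots> \<le> (\<Sum>i<p. card ?M * (avg X (\<lambda>n. (?v i n)\<^sup>2) / sqrt X))"
    by (intro sum_mono cross_predictability)
  also have "\<dots> = card ?M / sqrt X * ((\<Sum>i<p. \<Sum>n\<in>{1..X}. (?v i n)\<^sup>2) / X)"
    by (simp add: avg_eq_sum sum_distrib_left sum_divide_distrib mult.commute[of "sqrt X"])
  \<comment> \<open>Summing over the coordinates first produces squared norms of clipped gradients,
    so the bound does not depend on \<open>p\<close>.\<close>
  also have "(\<Sum>i<p. \<Sum>n\<in>{1..X}. (?v i n)\<^sup>2) = (\<Sum>n\<in>{1..X}. \<Sum>i<p. (?v i n)\<^sup>2)"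
    by (rule sum.swap)
  also have "card ?M / sqrt X * ((\<Sum>n\<in>{1..X}. \<Sum>i<p. (?v i n)\<^sup>2) / X) \<le> card ?M / sqrt X * R\<^sup>2"
  proof (intro mult_left_mono)
    have "(\<Sum>n\<in>{1..X}. \<Sum>i<p. (?v i n)\<^sup>2) \<le> (\<Sum>n\<in>{1..X}. R\<^sup>2)"
      by (intro sum_mono sum_proj_ball_sq_le R_nonneg)
    thus "(\<Sum>n\<in>{1..X}. \<Sum>i<p. (?v i n)\<^sup>2) / X \<le> R\<^sup>2"
      by (cases "X = 0") (simp_all add: divide_le_eq mult.commute)
  qed simp
  finally have "(\<Sum>h\<in>?M. \<Sum>i<p. (G h \<theta> i - G sq \<theta> i)\<^sup>2) / (2 * \<tau>\<^sup>2)
      \<le> card ?M / sqrt X * R\<^sup>2 / (2 * \<tau>\<^sup>2)"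
    by (rule divide_right_mono) simp
  thus ?thesis
    by (simp add: step_cost_def mult_ac flip: sum_divide_distrib)
qed

text \<open>A set of parameters, so that success for \<open>h\<close> can also be tested on the
  output of a run with another target.\<close>

definition success :: "real \<Rightarrow> (nat \<Rightarrow> real) \<Rightarrow> (nat \<Rightarrow> real) set" where
  "success L h = {\<theta>. (l2norm X (\<lambda>n. f n \<theta> - h n))\<^sup>2 \<le> (l2norm X (\<lambda>n. h n - sq n))\<^sup>2 - L}"

lemma measurable_success: "(indicator (success L h) :: _ \<Rightarrow> real) \<in> borel_measurable (param_space p)"
proof -
  have [measurable]: "f n \<in> borel_measurable (param_space p)" if "n \<in> {1..X}" for n
    using model that by (auto simp: param_model_def)
  have "(\<lambda>\<theta>. (l2norm X (\<lambda>n. f n \<theta> - h n))\<^sup>2) \<in> borel_measurable (param_space p)"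
    unfolding l2norm_sq avg_eq_sum by measurable
  hence "{\<theta>\<in>space (param_space p). (l2norm X (\<lambda>n. f n \<theta> - h n))\<^sup>2 \<le> (l2norm X (\<lambda>n. h n - sq n))\<^sup>2 - L}
      \<in> sets (param_space p)"
    by measurable
  thus ?thesis
    by (subst borel_measurable_indicator_iff) (simp add: success_def Int_def conj_commute)
qed

text \<open>
  The Donsker--Varadhan bound for minus the indicator of the success set, linearised by
  \<open>exp x \<ge> 1 + x\<close> and \<open>1 - exp (-1) \<ge> 1/2\<close>.
\<close>

lemma success_prob_le:
  assumes \<theta>0: "\<theta>0 \<in> space (param_space p)"
  shows "measure (noises T) {\<xi>\<in>space (noises T). gd h \<theta>0 \<xi> T \<in> success L h}
    \<le> 2 * (\<integral>\<xi>. indicator (success L h) (gd h' \<theta>0 \<xi> T) + (\<Sum>k<T. step_cost h h' (gd h' \<theta>0 \<xi> k)) \<partial>noises T)"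
    (is "?P \<le> 2 * ?I")
proof -
  interpret P: prob_space "noises T"
    by (rule prob_space_noises)
  let ?A = "success L h"
  let ?J = "\<lambda>\<xi>. indicator ?A (gd h \<theta>0 \<xi> T) :: real"
  have J_meas: "?J \<in> borel_measurable (noises T)"
    using measurable_compose[OF measurable_gd[OF \<theta>0 order_refl] measurable_success] .
  have int_J: "integrable (noises T) ?J"
    by (rule P.integrable_const_bound[of _ 1]) (use J_meas in auto)
  have "(\<integral>\<xi>. ?J \<xi> \<partial>noises T) = (\<integral>\<xi>. indicator {\<xi>. gd h \<theta>0 \<xi> T \<in> ?A} \<xi> \<partial>noises T)"
    by (intro Bochner_Integration.integral_cong) (auto simp: indicator_def)
  hence P_eq: "(\<integral>\<xi>. ?J \<xi> \<partial>noises T) = ?P"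
    by (simp add: Int_def conj_commute)
  have "1 - ?I \<le> exp (- ?I)"
    using exp_ge_add_one_self[of "- ?I"] by simp
  also have "- ?I = (\<integral>\<xi>. - indicator ?A (gd h' \<theta>0 \<xi> T) - (\<Sum>k<T. step_cost h h' (gd h' \<theta>0 \<xi> k)) \<partial>noises T)"
    by (subst Bochner_Integration.integral_minus[symmetric]) simp
  also have "exp \<dots> \<le> (\<integral>\<xi>. exp (- ?J \<xi>) \<partial>noises T)"
    by (rule change_of_target[OF \<theta>0 borel_measurable_uminus[OF measurable_success], of _ _ 1])
      (simp add: indicator_def)
  also have "\<dots> \<le> (\<integral>\<xi>. 1 - ?J \<xi> / 2 \<partial>noises T)"
  proof (rule integral_mono)
    show "integrable (noises T) (\<lambda>\<xi>. exp (- ?J \<xi>))"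
      by (rule P.integrable_const_bound[of _ 1]) (use J_meas in auto)
    show "integrable (noises T) (\<lambda>\<xi>. 1 - ?J \<xi> / 2)"
      using int_J by simp
    have "2 \<le> exp (1::real)"
      using exp_ge_add_one_self[of "1::real"] by simp
    thus "exp (- ?J \<xi>) \<le> 1 - ?J \<xi> / 2" for \<xi>
      by (auto simp: indicator_def exp_minus field_simps)
  qed
  also have "\<dots> = 1 - ?P / 2"
    using int_J P_eq by (simp add: P.prob_space)
  finally show ?thesis by simp
qed

text \<open>The reference run has target \<open>sq\<close>, the same for all \<open>h\<close>. Hence
  the sum over \<open>h\<close> can be taken inside the integral and estimated for each fixed
  noise.\<close>

lemma sum_success_prob_le:
  assumes \<theta>0: "\<theta>0 \<in> space (param_space p)" and L: "L > 0"
  shows "(\<Sum>h\<in>mult_sign_funs X. measure (noises T) {\<xi>\<in>space (noises T). gd h \<theta>0 \<xi> T \<in> success L h})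
    \<le> card (mult_sign_funs X) * (2 / (L * sqrt X) + T * (R / \<tau>)\<^sup>2 / sqrt X)"
proof -
  interpret P: prob_space "noises T"
    by (rule prob_space_noises)
  let ?M = "mult_sign_funs X"
  let ?Z = "\<lambda>h \<xi>. indicator (success L h) (gd sq \<theta>0 \<xi> T) + (\<Sum>k<T. step_cost h sq (gd sq \<theta>0 \<xi> k))"
  have int_Z: "integrable (noises T) (?Z h)" for h
  proof (intro Bochner_Integration.integrable_add Bochner_Integration.integrable_sum)
    show "integrable (noises T) (\<lambda>\<xi>. indicator (success L h) (gd sq \<theta>0 \<xi> T) :: real)"
      using measurable_compose[OF measurable_gd[OF \<theta>0 order_refl] measurable_success]
      by (intro P.integrable_const_bound[of _ 1]) auto
    fix k assume "k \<in> {..<T}"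
    hence m: "(\<lambda>\<xi>. step_cost h sq (gd sq \<theta>0 \<xi> k)) \<in> borel_measurable (noises T)"
      by (intro measurable_compose[OF measurable_gd[OF \<theta>0] measurable_step_cost]) simp
    obtain B where "step_cost h sq \<theta> \<le> B" for \<theta>
      using step_cost_bounded by blast
    thus "integrable (noises T) (\<lambda>\<xi>. step_cost h sq (gd sq \<theta>0 \<xi> k))"
      using m by (intro P.integrable_const_bound[of _ B]) (auto simp: step_cost_nonneg)
  qed
  have "(\<Sum>h\<in>?M. measure (noises T) {\<xi>\<in>space (noises T). gd h \<theta>0 \<xi> T \<in> success L h})
      \<le> (\<Sum>h\<in>?M. 2 * (\<integral>\<xi>. ?Z h \<xi> \<partial>noises T))"
    by (intro sum_mono success_prob_le \<theta>0)
  also have "\<dots> = 2 * (\<integral>\<xi>. (\<Sum>h\<in>?M. ?Z h \<xi>) \<partial>noises T)"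
    using int_Z by (subst Bochner_Integration.integral_sum) (simp_all add: sum_distrib_left)
  also have "\<dots> \<le> 2 * (\<integral>\<xi>. card ?M / (L * sqrt X) + T * (card ?M * (R\<^sup>2 / (2 * \<tau>\<^sup>2 * sqrt X))) \<partial>noises T)"
  proof (intro mult_left_mono integral_mono)
    show "integrable (noises T) (\<lambda>\<xi>. \<Sum>h\<in>?M. ?Z h \<xi>)"
      by (intro Bochner_Integration.integrable_sum int_Z)
    fix \<xi>
    \<comment> \<open>With \<open>\<xi>\<close> fixed, the output of the reference run is one fixed
      predictor, and each of its steps contributes one averaged cost.\<close>
    have "(\<Sum>h\<in>?M. ?Z h \<xi>) = (\<Sum>h\<in>?M. of_bool (gd sq \<theta>0 \<xi> T \<in> success L h))
        + (\<Sum>k<T. \<Sum>h\<in>?M. step_cost h sq (gd sq \<theta>0 \<xi> k))"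
      unfolding sum.distrib by (subst (2) sum.swap) (simp add: indicator_def of_bool_def)
    also have "(\<Sum>h\<in>?M. of_bool (gd sq \<theta>0 \<xi> T \<in> success L h)) \<le> card ?M / (L * sqrt X)"
      unfolding success_def mem_Collect_eq by (rule fixed_predictor_success_le[OF L])
    also have "(\<Sum>k<T. \<Sum>h\<in>?M. step_cost h sq (gd sq \<theta>0 \<xi> k))
        \<le> T * (card ?M * (R\<^sup>2 / (2 * \<tau>\<^sup>2 * sqrt X)))"
      by (rule order_trans[OF sum_bounded_above[OF sum_step_cost_le]]) simp
    finally show "(\<Sum>h\<in>?M. ?Z h \<xi>) \<le> card ?M / (L * sqrt X) + T * (card ?M * (R\<^sup>2 / (2 * \<tau>\<^sup>2 * sqrt X)))"
      by simp
  qed auto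
  also have "\<dots> = card ?M * (2 / (L * sqrt X) + T * (R / \<tau>)\<^sup>2 / sqrt X)"
    by (simp add: P.prob_space power_divide field_simps)
  finally show ?thesis .
qed

text \<open>Fubini's theorem reduces the claim to fixed initial parameters, where the average over
  targets has been estimated.\<close>

lemma training_success_prob_le:
  assumes L: "L > 0" and \<mu>0: "prob_space \<mu>0" "sets \<mu>0 = sets (param_space p)"
  shows "\<P>((h, \<theta>0, \<xi>) in training_space X p \<tau> T \<mu>0. gd h \<theta>0 \<xi> T \<in> success L h)
    \<le> 2 / (L * sqrt X) + T * (R / \<tau>)\<^sup>2 / sqrt X" (is "measure ?S ?E \<le> ?B")
\<comment> \<open>A set outside the sigma-algebra has \<open>measure\<close> 0 by default, and the
  bound is nonnegative.\<close>
proof (cases "?E \<in> sets ?S")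
  case False
  thus ?thesis
    using L by (simp add: measure_notin_sets)
next
  case E: True
  interpret P: prob_space "noises T"
    by (rule prob_space_noises)
  interpret \<mu>0: prob_space \<mu>0
    by fact
  interpret Q: pair_prob_space \<mu>0 "noises T" ..
  let ?M = "mult_sign_funs X"
  let ?N = "\<mu>0 \<Otimes>\<^sub>M noises T"
  let ?U = "uniform_count_measure ?M"
  let ?A = "\<lambda>h \<theta>0. Pair \<theta>0 -` Pair h -` ?E"
  have sp: "space \<mu>0 = space (param_space p)"
    by (rule sets_eq_imp_space_eq[OF \<mu>0(2)])
  have cM: "card ?M > 0"
    using finite_mult_sign_funs mult_sign_funs_nonempty by (simp add: card_gt_0_iff)
  have E': "?E \<in> sets (?U \<Otimes>\<^sub>M ?N)"
    using E by (simp add: training_space_def)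
  have slice: "Pair h -` ?E \<in> sets ?N" for h
    using E' by (rule sets_Pair1)
  have slice2: "?A h \<theta>0 = {\<xi>\<in>space (noises T). gd h \<theta>0 \<xi> T \<in> success L h}"
    if "h \<in> ?M" "\<theta>0 \<in> space \<mu>0" for h \<theta>0
    using that by (auto simp: training_space_def space_pair_measure space_uniform_count_measure)
  have "emeasure ?S ?E = (\<integral>\<^sup>+h. emeasure ?N (Pair h -` ?E) \<partial>?U)"
    using E' unfolding training_space_def by (rule Q.emeasure_pair_measure_alt)
  also have "\<dots> = (\<Sum>h\<in>?M. ennreal (1 / card ?M) * emeasure ?N (Pair h -` ?E))"
    by (simp add: uniform_count_measure_def nn_integral_point_measure_finite finite_mult_sign_funs mult.commute)
  also have "\<dots> = (\<Sum>h\<in>?M. ennreal (1 / card ?M) * (\<integral>\<^sup>+\<theta>0. emeasure (noises T) (?A h \<theta>0) \<partial>\<mu>0))"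
    by (simp only: P.emeasure_pair_measure_alt[OF slice])
  \<comment> \<open>The sum over \<open>h\<close> must go inside, because the estimate holds for the
    sum and not for each target.\<close>
  also have "\<dots> = (\<integral>\<^sup>+\<theta>0. (\<Sum>h\<in>?M. ennreal (1 / card ?M) * emeasure (noises T) (?A h \<theta>0)) \<partial>\<mu>0)"
    using P.measurable_emeasure_Pair[OF slice]
    by (simp add: nn_integral_sum nn_integral_cmult)
  also have "\<dots> \<le> (\<integral>\<^sup>+\<theta>0. ennreal ?B \<partial>\<mu>0)"
  proof (rule nn_integral_mono)
    fix \<theta>0 assume \<theta>0: "\<theta>0 \<in> space \<mu>0"
    have "(\<Sum>h\<in>?M. ennreal (1 / card ?M) * emeasure (noises T) (?A h \<theta>0))
        = ennreal ((\<Sum>h\<in>?M. measure (noises T) {\<xi>\<in>space (noises T). gd h \<theta>0 \<xi> T \<in> success L h}) / card ?M)"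
    proof -
      have "ennreal (1 / card ?M) * emeasure (noises T) (?A h \<theta>0)
          = ennreal (measure (noises T) {\<xi>\<in>space (noises T). gd h \<theta>0 \<xi> T \<in> success L h} / card ?M)"
        if "h \<in> ?M" for h
        unfolding slice2[OF that \<theta>0] P.emeasure_eq_measure by (simp flip: ennreal_mult'')
      hence "(\<Sum>h\<in>?M. ennreal (1 / card ?M) * emeasure (noises T) (?A h \<theta>0))
          = (\<Sum>h\<in>?M. ennreal (measure (noises T) {\<xi>\<in>space (noises T). gd h \<theta>0 \<xi> T \<in> success L h} / card ?M))"
        by (rule sum.cong[OF refl])
      thus ?thesis
        by (simp add: sum_divide_distrib)
    qed
    also have "\<dots> \<le> ennreal ?B"
      using sum_success_prob_le[of \<theta>0 L T] \<theta>0 L cM unfolding sp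
      by (intro ennreal_leI) (simp add: divide_le_eq mult.commute)
    finally show "(\<Sum>h\<in>?M. ennreal (1 / card ?M) * emeasure (noises T) (?A h \<theta>0)) \<le> ennreal ?B" .
  qed
  also have "\<dots> = ennreal ?B"
    by (simp add: \<mu>0.emeasure_space_1)
  finally show ?thesis
    using L by (simp add: measure_def enn2real_leI)
qed

end

text \<open>The exponent \<open>-1/2\<close> lies strictly below \<open>-\<delta>\<close>, which
  leaves room for a power of the logarithm.\<close>

lemma rate_of_threshold:
  assumes "\<delta> < 1 / 4"
  shows "(\<lambda>x::real. 2 / (ln x powr (- C) * sqrt x)) \<in> O(\<lambda>x. x powr (- \<delta>))"
  using assms by real_asymp

theorem theorem1p6:
  fixes X p T :: "nat \<Rightarrow> nat"
    and R \<tau> :: "nat \<Rightarrow> real"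
    and \<eta> :: "nat \<Rightarrow> nat \<Rightarrow> real"
    and \<mu>0 :: "nat \<Rightarrow> (nat \<Rightarrow> real) measure"
    and f :: "nat \<Rightarrow> nat \<Rightarrow> (nat \<Rightarrow> real) \<Rightarrow> real"
    and g :: "nat \<Rightarrow> nat \<Rightarrow> (nat \<Rightarrow> real) \<Rightarrow> nat \<Rightarrow> real"
    and C \<delta> :: real
  assumes "\<And>d. 1 \<le> X d"
    and "filterlim X at_top at_top"
    and "0 < C"
    and "0 < \<delta>" and "\<delta> < 1 / 4"
    and "\<And>d. param_model (X d) (p d) (f d) (g d)"
    and "\<And>d. prob_space (\<mu>0 d)"
    and "\<And>d. sets (\<mu>0 d) = sets (param_space (p d))"
    and "\<And>d. 0 < R d"
    and "\<And>d. 0 < \<tau> d"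
    and "\<And>d k. k < T d \<Longrightarrow> 0 < \<eta> d k"
    and "(\<lambda>d. real (T d) * (R d / \<tau> d)\<^sup>2) \<in> O(\<lambda>d. real (X d) powr (1 / 2 - 2 * \<delta>))"
  shows "(\<lambda>d. \<P>((h, \<theta>0, \<xi>) in training_space (X d) (p d) (\<tau> d) (T d) (\<mu>0 d).
            (l2norm (X d)
               (\<lambda>n. f d n (noisy_gd (X d) (p d) (R d) (f d) (g d) (\<eta> d) h \<theta>0 \<xi> (T d)) - h n))\<^sup>2
            \<le> (l2norm (X d) (\<lambda>n. h n - of_bool (is_square n)))\<^sup>2 - ln (real (X d)) powr (- C)))
         \<in> O(\<lambda>d. real (X d) powr (- \<delta>))" (is "?Pr \<in> _")
proof -
  define B1 where "B1 = (\<lambda>d. 2 / (ln (real (X d)) powr (- C) * sqrt (X d)))"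
  define B2 where "B2 = (\<lambda>d. T d * (R d / \<tau> d)\<^sup>2 / sqrt (X d))"
  have X_lim: "filterlim (\<lambda>d. real (X d)) at_top at_top"
    using filterlim_compose[OF filterlim_real_sequentially assms(2)] .
  have bound: "eventually (\<lambda>d. norm (?Pr d) \<le> norm (B1 d + B2 d)) at_top"
    \<comment> \<open>Beyond \<open>X d = 1\<close> the logarithm is positive, and hence so is the
      margin.\<close>
    using eventually_compose_filterlim[OF eventually_gt_at_top X_lim, of 1]
  proof eventually_elim
    case (elim d)
    interpret training "X d" "p d" "R d" "\<tau> d" "f d" "g d" "\<eta> d"
      using assms(6,9,10) by unfold_locales (simp_all add: less_imp_le)
    have L: "ln (real (X d)) powr (- C) > 0"
      using elim by simp
    have "?Pr d \<le> B1 d + B2 d"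
      using training_success_prob_le[OF L assms(7)[of d] assms(8)[of d], of "T d"]
      by (simp add: success_def B1_def B2_def)
    moreover have "0 \<le> ?Pr d"
      by simp
    ultimately show ?case by simp
  qed
  have B1: "B1 \<in> O(\<lambda>d. real (X d) powr (- \<delta>))"
    unfolding B1_def using landau_o.big.compose[OF rate_of_threshold[OF assms(5)] X_lim] .
  have "B2 \<in> O(\<lambda>d. real (X d) powr (1 / 2 - 2 * \<delta>) / sqrt (X d))"
    unfolding B2_def using assms(1)
    by (intro landau_o.big.divide_right[OF _ assms(12)] always_eventually allI) (simp add: not_less_eq_eq le_simps Suc_le_eq)
  \<comment> \<open>The exponents add up to \<open>-2 * \<delta>\<close>, which is below
    \<open>-\<delta>\<close>.\<close>
  also have "(\<lambda>x::real. x powr (1 / 2 - 2 * \<delta>) / sqrt x) \<in> O(\<lambda>x. x powr (- \<delta>))"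
    using assms(4) by real_asymp
  from landau_o.big.compose[OF this X_lim]
  have "(\<lambda>d. real (X d) powr (1 / 2 - 2 * \<delta>) / sqrt (X d)) \<in> O(\<lambda>d. real (X d) powr (- \<delta>))" .
  finally have B2: "B2 \<in> O(\<lambda>d. real (X d) powr (- \<delta>))" .
  have "?Pr \<in> O(\<lambda>d. B1 d + B2 d)"
    using bound by (rule landau_o.big_mono)
  also have "(\<lambda>d. B1 d + B2 d) \<in> O(\<lambda>d. real (X d) powr (- \<delta>))"
    by (rule sum_in_bigo(1)[OF B1 B2])
  finally show ?thesis .
qed

end
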